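(* Let $k$ be any commutative unital ring. Suppose that for every model $\Lambda V\to k$ of the chain algebra $k$ ($V$ an arbitrary free non-negatively graded $k$-module), the spectral sequence $E^1_{p,q}=H_q(C_{p,*}(\Lambda V),b)\Rightarrow HH_{p+q}(\Lambda V)=\widehat{HH}_{p+q}(k)$ degenerates at the second term, i.e. $E^2=E^\infty$. Then $k\supset\mathbb{Q}$, i.e. every positive integer is invertible in $k$.
   Context: **Chain algebras.** A chain algebra over $k$ is a unital $k$-algebra $A=\bigoplus_{n\ge0}A_n$, graded, with a differential $\partial:A_n\to A_{n-1}$, $\partial^2=0$, $\partial(ab)=\partial(a)b+(-1)^{|a|}a\partial(b)$, which is strictly graded commutative: $ba=(-1)^{|a||b|}ab$, and $a^2=0$ for $|a|$ odd. It is called free if, as a graded algebra, it is the graded symmetric algebra $\Lambda V$ (polynomial on even generators, exterior on odd generators) of some free non-negatively graded $k$-module $V$; no condition is imposed on $\partial$. The ring $k$ is a chain algebra concentrated in degree $0$. A model of a chain algebra $A$ is a surjective quasi-isomorphism of chain algebras $\Lambda V\to A$ with $\Lambda V$ free. **Hochschild homology and its spectral sequence.** $C_{p,q}(\Lambda V)=(\Lambda V\otimes(\Lambda V/k)^{\otimes q})_p$ (the subscript $p$ is the internal degree coming from $\Lambda V$), with the Hochschild boundary $b:C_{p,q}\to C_{p,q-1}$ and the boundary $\partial:C_{p,q}\to C_{p-1,q}$ induced by that of $\Lambda V$ (multiplied by $(-1)^q$), with the usual Koszul signs. $HH_*(\Lambda V)$ is the homology of the total complex of this double complex, and the spectral sequence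 $E$ is that of its column filtration; $E^2$ is the homology of $E^1$ with respect to the map induced by $\partial$. For a chain algebra $A$, $\widehat{HH}_n(A):=HH_n(\Lambda V)$ for a model $\Lambda V\to A$ (independent of the model up to isomorphism). *)

theory Defs
  imports Complex_Main "HOL-Library.Multiset" "HOL-Library.Poly_Mapping"
begin

section \<open>Subquotients\<close>

text \<open>
  The quotient \<open>Z / B\<close> of additive subgroups of an ambient group, as the set of cosets.
\<close>

definition subquot :: "'a::ab_group_add set \<Rightarrow> 'a set \<Rightarrow> 'a set set" where
  "subquot Z B = Z // {(x, y). x \<in> Z \<and> y \<in> Z \<and> x - y \<in> B}"


section \<open>Chain algebras\<close>

text \<open>
  The underlying set \<open>carrier_of A\<close> of a chain algebra \<open>A\<close> is the submodule of an ambient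
  \<open>'k\<close>-module spanned by the homogeneous components \<open>hom_part A n\<close>. The values of the
  operations outside of the carrier are irrelevant.
\<close>

record ('k, 'a) chain_alg =
  hom_part :: "nat \<Rightarrow> 'a set"
  scl :: "'k \<Rightarrow> 'a \<Rightarrow> 'a"
  mul :: "'a \<Rightarrow> 'a \<Rightarrow> 'a"
  unity :: "'a"
  bdry :: "'a \<Rightarrow> 'a"

definition carrier_of :: "('k::comm_ring_1, 'a::ab_group_add) chain_alg \<Rightarrow> 'a set" where
  "carrier_of A = module.span (scl A) (\<Union>n. hom_part A n)"

locale chain_algebra =
  fixes A :: "('k::comm_ring_1, 'a::ab_group_add) chain_alg"
  assumes module: "module (scl A)"
    and subspace: "module.subspace (scl A) (hom_part A n)"
    and direct: "\<lbrakk>\<And>i. i \<le> n \<Longrightarrow> f i \<in> hom_part A i; (\<Sum>i\<le>n. f i) = 0; j \<le> n\<rbrakk> \<Longrightarrow> f j = 0"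
    and mul_add_left:
      "\<lbrakk>a \<in> carrier_of A; b \<in> carrier_of A; c \<in> carrier_of A\<rbrakk>
        \<Longrightarrow> mul A (a + b) c = mul A a c + mul A b c"
    and mul_add_right:
      "\<lbrakk>a \<in> carrier_of A; b \<in> carrier_of A; c \<in> carrier_of A\<rbrakk>
        \<Longrightarrow> mul A a (b + c) = mul A a b + mul A a c"
    and mul_scl_left:
      "\<lbrakk>a \<in> carrier_of A; b \<in> carrier_of A\<rbrakk> \<Longrightarrow> mul A (scl A t a) b = scl A t (mul A a b)"
    and mul_scl_right:
      "\<lbrakk>a \<in> carrier_of A; b \<in> carrier_of A\<rbrakk> \<Longrightarrow> mul A a (scl A t b) = scl A t (mul A a b)"
    and mul_assoc:
      "\<lbrakk>a \<in> carrier_of A; b \<in> carrier_of A; c \<in> carrier_of A\<rbrakk>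
        \<Longrightarrow> mul A (mul A a b) c = mul A a (mul A b c)"
    and unity_mul: "a \<in> carrier_of A \<Longrightarrow> mul A (unity A) a = a"
    and mul_unity: "a \<in> carrier_of A \<Longrightarrow> mul A a (unity A) = a"
    and unity_in: "unity A \<in> hom_part A 0"
    and mul_in: "\<lbrakk>a \<in> hom_part A m; b \<in> hom_part A n\<rbrakk> \<Longrightarrow> mul A a b \<in> hom_part A (m + n)"
    and graded_commutative:
      "\<lbrakk>a \<in> hom_part A m; b \<in> hom_part A n\<rbrakk> \<Longrightarrow> mul A b a = scl A ((-1) ^ (m * n)) (mul A a b)"
    and odd_square: "\<lbrakk>a \<in> hom_part A n; odd n\<rbrakk> \<Longrightarrow> mul A a a = 0"
    and bdry_add:
      "\<lbrakk>a \<in> carrier_of A; b \<in> carrier_of A\<rbrakk> \<Longrightarrow> bdry A (a + b) = bdry A a + bdry A b"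
    and bdry_scl: "a \<in> carrier_of A \<Longrightarrow> bdry A (scl A t a) = scl A t (bdry A a)"
    and bdry_in: "a \<in> hom_part A (Suc n) \<Longrightarrow> bdry A a \<in> hom_part A n"
    and bdry_0: "a \<in> hom_part A 0 \<Longrightarrow> bdry A a = 0"
    and bdry_bdry: "a \<in> carrier_of A \<Longrightarrow> bdry A (bdry A a) = 0"
    and leibniz:
      "\<lbrakk>a \<in> hom_part A m; b \<in> hom_part A n\<rbrakk>
        \<Longrightarrow> bdry A (mul A a b) = mul A (bdry A a) b + scl A ((-1) ^ m) (mul A a (bdry A b))"

definition chain_alg_hom ::
  "('k::comm_ring_1, 'a::ab_group_add) chain_alg \<Rightarrow> ('k, 'b::ab_group_add) chain_alg
    \<Rightarrow> ('a \<Rightarrow> 'b) \<Rightarrow> bool" where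
  "chain_alg_hom A B f \<longleftrightarrow>
     (\<forall>n. \<forall>a \<in> hom_part A n. f a \<in> hom_part B n) \<and>
     (\<forall>a \<in> carrier_of A. \<forall>a' \<in> carrier_of A. f (a + a') = f a + f a') \<and>
     (\<forall>t. \<forall>a \<in> carrier_of A. f (scl A t a) = scl B t (f a)) \<and>
     (\<forall>a \<in> carrier_of A. \<forall>a' \<in> carrier_of A. f (mul A a a') = mul B (f a) (f a')) \<and>
     f (unity A) = unity B \<and>
     (\<forall>a \<in> carrier_of A. f (bdry A a) = bdry B (f a))"

definition cycles :: "('k, 'a::ab_group_add) chain_alg \<Rightarrow> nat \<Rightarrow> 'a set" where
  "cycles A n = {a \<in> hom_part A n. bdry A a = 0}"

definition boundaries :: "('k, 'a::ab_group_add) chain_alg \<Rightarrow> nat \<Rightarrow> 'a set" where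
  "boundaries A n = bdry A ` hom_part A (Suc n)"

definition homology :: "('k, 'a::ab_group_add) chain_alg \<Rightarrow> nat \<Rightarrow> 'a set set" where
  "homology A n = subquot (cycles A n) (boundaries A n)"

text \<open>
  \<open>homology_map B f n\<close> sends the class of a cycle \<open>a\<close> to the class of \<open>f a\<close> in \<open>H\<^sub>n(B)\<close>.
\<close>

definition homology_map ::
  "('k, 'b::ab_group_add) chain_alg \<Rightarrow> ('a \<Rightarrow> 'b) \<Rightarrow> nat \<Rightarrow> 'a set \<Rightarrow> 'b set" where
  "homology_map B f n C = {b \<in> cycles B n. \<exists>a \<in> C. f a - b \<in> boundaries B n}"

definition quasi_iso ::
  "('k::comm_ring_1, 'a::ab_group_add) chain_alg \<Rightarrow> ('k, 'b::ab_group_add) chain_alg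
    \<Rightarrow> ('a \<Rightarrow> 'b) \<Rightarrow> bool" where
  "quasi_iso A B f \<longleftrightarrow> chain_alg_hom A B f \<and>
     (\<forall>n. bij_betw (homology_map B f n) (homology A n) (homology B n))"

definition ground :: "('k::comm_ring_1, 'k) chain_alg" where
  "ground = \<lparr>hom_part = (\<lambda>n. if n = 0 then UNIV else {0}), scl = (*), mul = (*),
     unity = 1, bdry = (\<lambda>_. 0)\<rparr>"


section \<open>Free graded commutative algebras\<close>

text \<open>
  A free graded module \<open>V\<close> is given by a homogeneous basis \<open>X\<close> with degrees \<open>deg\<close> and a linear
  order \<open>r\<close> on \<open>X\<close>. Then \<open>\<Lambda>V\<close> has as basis the monomials with factors written in increasing
  order, no odd generator being repeated; they are encoded as multisets, the unit being \<open>{#}\<close>.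
  An element of \<open>\<Lambda>V\<close> is the finitely supported function of its coefficients.
\<close>

definition mdeg :: "('x \<Rightarrow> nat) \<Rightarrow> 'x multiset \<Rightarrow> nat" where
  "mdeg deg m = (\<Sum>x\<in>#m. deg x)"

definition monomials :: "'x set \<Rightarrow> ('x \<Rightarrow> nat) \<Rightarrow> 'x multiset set" where
  "monomials X deg = {m. set_mset m \<subseteq> X \<and> (\<forall>x \<in># m. odd (deg x) \<longrightarrow> count m x = 1)}"

definition pscale :: "'k::comm_ring_1 \<Rightarrow> ('b \<Rightarrow>\<^sub>0 'k) \<Rightarrow> ('b \<Rightarrow>\<^sub>0 'k)" where
  "pscale c f = Poly_Mapping.map ((*) c) f"

definition lin_ext :: "('b \<Rightarrow> ('c \<Rightarrow>\<^sub>0 'k)) \<Rightarrow> ('b \<Rightarrow>\<^sub>0 'k) \<Rightarrow> ('c \<Rightarrow>\<^sub>0 'k::comm_ring_1)" where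
  "lin_ext \<phi> f = (\<Sum>m \<in> Poly_Mapping.keys f. pscale (Poly_Mapping.lookup f m) (\<phi> m))"

text \<open>
  Sorting the concatenation of two increasing monomials moves each odd \<open>y\<close> of the second one past
  all odd \<open>x > y\<close> of the first one; every such move contributes a sign.
\<close>

definition mono_mul ::
  "('x \<Rightarrow> nat) \<Rightarrow> 'x rel \<Rightarrow> 'x multiset \<Rightarrow> 'x multiset \<Rightarrow> ('x multiset \<Rightarrow>\<^sub>0 'k::comm_ring_1)" where
  "mono_mul deg r m m' =
     (if \<exists>x. x \<in># m \<and> x \<in># m' \<and> odd (deg x) then 0
      else Poly_Mapping.single (m + m')
        ((-1) ^ card {(x, y). x \<in># m \<and> y \<in># m' \<and> odd (deg x) \<and> odd (deg y) \<and> (y, x) \<in> r \<and> y \<noteq> x}))"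

definition lam_mul ::
  "('x \<Rightarrow> nat) \<Rightarrow> 'x rel \<Rightarrow> ('x multiset \<Rightarrow>\<^sub>0 'k) \<Rightarrow> ('x multiset \<Rightarrow>\<^sub>0 'k)
    \<Rightarrow> ('x multiset \<Rightarrow>\<^sub>0 'k::comm_ring_1)" where
  "lam_mul deg r f g = lin_ext (\<lambda>m. lin_ext (\<lambda>m'. mono_mul deg r m m') g) f"

definition free_alg ::
  "'x set \<Rightarrow> ('x \<Rightarrow> nat) \<Rightarrow> 'x rel \<Rightarrow> (('x multiset \<Rightarrow>\<^sub>0 'k) \<Rightarrow> ('x multiset \<Rightarrow>\<^sub>0 'k))
    \<Rightarrow> ('k::comm_ring_1, 'x multiset \<Rightarrow>\<^sub>0 'k) chain_alg" where
  "free_alg X deg r d =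
     \<lparr>hom_part = (\<lambda>n. {f. Poly_Mapping.keys f \<subseteq> {m \<in> monomials X deg. mdeg deg m = n}}),
      scl = pscale, mul = lam_mul deg r, unity = Poly_Mapping.single {#} 1, bdry = d\<rparr>"

text \<open>
  \<open>\<epsilon>\<close> is a surjective quasi-isomorphism from \<open>(\<Lambda>V, d)\<close> to \<open>A\<close>; the only requirement on \<open>d\<close> is
  that it makes \<open>\<Lambda>V\<close> a chain algebra. As a formula cannot quantify over types, ``every model'' means
  every model with a basis \<open>X\<close> in a fixed type \<open>'x\<close>. The type \<open>'x\<close> is arbitrary apart from being
  infinite and having at least the cardinality of \<open>'k\<close>.
\<close>

definition is_model ::
  "'x set \<Rightarrow> ('x \<Rightarrow> nat) \<Rightarrow> 'x rel \<Rightarrow> (('x multiset \<Rightarrow>\<^sub>0 'k) \<Rightarrow> ('x multiset \<Rightarrow>\<^sub>0 'k))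
    \<Rightarrow> ('k::comm_ring_1, 'a::ab_group_add) chain_alg \<Rightarrow> (('x multiset \<Rightarrow>\<^sub>0 'k) \<Rightarrow> 'a) \<Rightarrow> bool" where
  "is_model X deg r d A \<epsilon> \<longleftrightarrow>
     linear_order_on X r \<and> chain_algebra (free_alg X deg r d) \<and> chain_algebra A \<and>
     quasi_iso (free_alg X deg r d) A \<epsilon> \<and> \<epsilon> ` carrier_of (free_alg X deg r d) = carrier_of A"


section \<open>The Hochschild double complex\<close>

text \<open>
  \<open>\<Lambda>V \<otimes> (\<Lambda>V/k)\<^sup>\<otimes>\<^sup>q\<close> is free on the tensors \<open>m\<^sub>0 \<otimes> \<dots> \<otimes> m\<^sub>q\<close> of monomials with
  \<open>m\<^sub>i \<noteq> 1\<close> for \<open>i \<ge> 1\<close>. These are encoded as lists, so that all the modules of the double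
  complex, and its total complex, are submodules of \<open>'x multiset list \<Rightarrow>\<^sub>0 'k\<close>.
\<close>

definition hh_basis :: "'x set \<Rightarrow> ('x \<Rightarrow> nat) \<Rightarrow> nat \<Rightarrow> nat \<Rightarrow> 'x multiset list set" where
  "hh_basis X deg p q =
     {ms. length ms = Suc q \<and> set ms \<subseteq> monomials X deg \<and> {#} \<notin> set (tl ms) \<and>
          sum_list (map (mdeg deg) ms) = p}"

text \<open>
  The class of \<open>a\<^sub>0 \<otimes> \<dots> \<otimes> a\<^sub>q\<close>, expanded in this basis; terms with a factor \<open>1\<close> in a position
  \<open>\<ge> 1\<close> vanish.
\<close>

definition tens :: "('x multiset \<Rightarrow>\<^sub>0 'k) list \<Rightarrow> ('x multiset list \<Rightarrow>\<^sub>0 'k::comm_ring_1)" where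
  "tens as = (\<Sum>ms \<in> {ms \<in> listset (map Poly_Mapping.keys as). {#} \<notin> set (tl ms)}.
     Poly_Mapping.single ms (\<Prod>i<length as. Poly_Mapping.lookup (as ! i) (ms ! i)))"

text \<open>
  On \<open>a\<^sub>0 \<otimes> \<dots> \<otimes> a\<^sub>q\<close> the Hochschild boundary is
  \<open>\<Sum>\<^sub>i\<^sub><\<^sub>q (-1)\<^sup>i a\<^sub>0 \<otimes> \<dots> \<otimes> a\<^sub>ia\<^sub>i\<^sub>+\<^sub>1 \<otimes> \<dots> \<otimes> a\<^sub>q\<close> plus the cyclic term \<open>a\<^sub>qa\<^sub>0 \<otimes> a\<^sub>1 \<otimes> \<dots> \<otimes> a\<^sub>q\<^sub>-\<^sub>1\<close>
  with the sign \<open>(-1)\<^sup>q\<close> times the Koszul sign of moving \<open>a\<^sub>q\<close> to the front.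
\<close>

definition hh_b_basis ::
  "('x \<Rightarrow> nat) \<Rightarrow> 'x rel \<Rightarrow> 'x multiset list \<Rightarrow> ('x multiset list \<Rightarrow>\<^sub>0 'k::comm_ring_1)" where
  "hh_b_basis deg r ms =
     (let q = length ms - 1; as = map (\<lambda>m. Poly_Mapping.single m (1::'k)) ms in
      if q = 0 then 0
      else (\<Sum>i<q. pscale ((-1) ^ i)
              (tens (take i as @ [lam_mul deg r (as ! i) (as ! Suc i)] @ drop (i + 2) as)))
         + pscale ((-1) ^ (q + mdeg deg (ms ! q) * sum_list (map (mdeg deg) (take q ms))))
              (tens (lam_mul deg r (as ! q) (as ! 0) # take (q - 1) (tl as))))"

definition hh_d_basis ::
  "('x \<Rightarrow> nat) \<Rightarrow> (('x multiset \<Rightarrow>\<^sub>0 'k) \<Rightarrow> ('x multiset \<Rightarrow>\<^sub>0 'k)) \<Rightarrow> 'x multiset list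
    \<Rightarrow> ('x multiset list \<Rightarrow>\<^sub>0 'k::comm_ring_1)" where
  "hh_d_basis deg d ms =
     (let q = length ms - 1; as = map (\<lambda>m. Poly_Mapping.single m (1::'k)) ms in
      pscale ((-1) ^ q)
        (\<Sum>i\<le>q. pscale ((-1) ^ sum_list (map (mdeg deg) (take i ms))) (tens (as[i := d (as ! i)]))))"

definition hh_total ::
  "('x \<Rightarrow> nat) \<Rightarrow> 'x rel \<Rightarrow> (('x multiset \<Rightarrow>\<^sub>0 'k) \<Rightarrow> ('x multiset \<Rightarrow>\<^sub>0 'k))
    \<Rightarrow> ('x multiset list \<Rightarrow>\<^sub>0 'k) \<Rightarrow> ('x multiset list \<Rightarrow>\<^sub>0 'k::comm_ring_1)" where
  "hh_total deg r d x = lin_ext (hh_b_basis deg r) x + lin_ext (hh_d_basis deg d) x"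


section \<open>The spectral sequence of the column filtration\<close>

text \<open>
  \<open>hh_filt X deg s n\<close> is the part \<open>F\<^sub>s Tot\<^sub>n\<close> of the total complex, spanned by the \<open>C\<^sub>p\<^sub>,\<^sub>q\<close> with
  \<open>p + q = n\<close> and \<open>p \<le> s\<close>.
\<close>

definition hh_filt ::
  "'x set \<Rightarrow> ('x \<Rightarrow> nat) \<Rightarrow> int \<Rightarrow> int \<Rightarrow> ('x multiset list \<Rightarrow>\<^sub>0 'k::comm_ring_1) set" where
  "hh_filt X deg s n =
     {x. Poly_Mapping.keys x \<subseteq> (\<Union>(p, q) \<in> {(p, q). int p + int q = n \<and> int p \<le> s}. hh_basis X deg p q)}"

text \<open>
  The index \<open>k \<ge> 1\<close> is the number of the page. With \<open>A\<^sup>k\<^sub>p = {x \<in> F\<^sub>p. D x \<in> F\<^sub>p\<^sub>-\<^sub>k}\<close>, where \<open>D\<close> is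
  the total differential, \<open>Z\<^sup>k\<^sub>p\<close> and \<open>B\<^sup>k\<^sub>p\<close> are the images of \<open>A\<^sup>k\<^sub>p\<close> and \<open>D(A\<^sup>k\<^sup>-\<^sup>1\<^sub>p\<^sub>+\<^sub>k\<^sub>-\<^sub>1)\<close> in
  \<open>F\<^sub>p/F\<^sub>p\<^sub>-\<^sub>1\<close>, and \<open>E\<^sup>k = Z\<^sup>k/B\<^sup>k\<close>, \<open>E\<^sup>\<infinity> = (\<Inter>\<^sub>k Z\<^sup>k)/(\<Union>\<^sub>k B\<^sup>k)\<close>. All these submodules of
  \<open>F\<^sub>p/F\<^sub>p\<^sub>-\<^sub>1\<close> are represented by their preimages in \<open>F\<^sub>p\<close>.
\<close>

definition hh_A ::
  "'x set \<Rightarrow> ('x \<Rightarrow> nat) \<Rightarrow> 'x rel \<Rightarrow> (('x multiset \<Rightarrow>\<^sub>0 'k) \<Rightarrow> ('x multiset \<Rightarrow>\<^sub>0 'k))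
    \<Rightarrow> nat \<Rightarrow> int \<Rightarrow> int \<Rightarrow> ('x multiset list \<Rightarrow>\<^sub>0 'k::comm_ring_1) set" where
  "hh_A X deg r d k p n =
     {x \<in> hh_filt X deg p n. hh_total deg r d x \<in> hh_filt X deg (p - int k) (n - 1)}"

definition hh_Z ::
  "'x set \<Rightarrow> ('x \<Rightarrow> nat) \<Rightarrow> 'x rel \<Rightarrow> (('x multiset \<Rightarrow>\<^sub>0 'k) \<Rightarrow> ('x multiset \<Rightarrow>\<^sub>0 'k))
    \<Rightarrow> nat \<Rightarrow> int \<Rightarrow> int \<Rightarrow> ('x multiset list \<Rightarrow>\<^sub>0 'k::comm_ring_1) set" where
  "hh_Z X deg r d k p q =
     {x + y | x y. x \<in> hh_A X deg r d k p (p + q) \<and> y \<in> hh_filt X deg (p - 1) (p + q)}"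

definition hh_B ::
  "'x set \<Rightarrow> ('x \<Rightarrow> nat) \<Rightarrow> 'x rel \<Rightarrow> (('x multiset \<Rightarrow>\<^sub>0 'k) \<Rightarrow> ('x multiset \<Rightarrow>\<^sub>0 'k))
    \<Rightarrow> nat \<Rightarrow> int \<Rightarrow> int \<Rightarrow> ('x multiset list \<Rightarrow>\<^sub>0 'k::comm_ring_1) set" where
  "hh_B X deg r d k p q =
     {hh_total deg r d x + y | x y.
        x \<in> hh_A X deg r d (k - 1) (p + int k - 1) (p + q + 1) \<and> y \<in> hh_filt X deg (p - 1) (p + q)}"

definition hh_E ::
  "'x set \<Rightarrow> ('x \<Rightarrow> nat) \<Rightarrow> 'x rel \<Rightarrow> (('x multiset \<Rightarrow>\<^sub>0 'k) \<Rightarrow> ('x multiset \<Rightarrow>\<^sub>0 'k))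
    \<Rightarrow> nat \<Rightarrow> int \<Rightarrow> int \<Rightarrow> ('x multiset list \<Rightarrow>\<^sub>0 'k::comm_ring_1) set set" where
  "hh_E X deg r d k p q = subquot (hh_Z X deg r d k p q) (hh_B X deg r d k p q)"

definition hh_E_infinity ::
  "'x set \<Rightarrow> ('x \<Rightarrow> nat) \<Rightarrow> 'x rel \<Rightarrow> (('x multiset \<Rightarrow>\<^sub>0 'k) \<Rightarrow> ('x multiset \<Rightarrow>\<^sub>0 'k))
    \<Rightarrow> int \<Rightarrow> int \<Rightarrow> ('x multiset list \<Rightarrow>\<^sub>0 'k::comm_ring_1) set set" where
  "hh_E_infinity X deg r d p q =
     subquot (\<Inter>k\<in>{1..}. hh_Z X deg r d k p q) (\<Union>k\<in>{1..}. hh_B X deg r d k p q)"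

text \<open>
  Both sides are sets of cosets in \<open>F\<^sub>p\<close>, and the equality says that the inclusions
  \<open>B\<^sup>2 \<subseteq> B\<^sup>\<infinity> \<subseteq> Z\<^sup>\<infinity> \<subseteq> Z\<^sup>2\<close> of subgroups satisfy \<open>B\<^sup>2 = B\<^sup>\<infinity>\<close> and \<open>Z\<^sup>\<infinity> = Z\<^sup>2\<close>.
\<close>

definition degenerates_at_E2 ::
  "'x set \<Rightarrow> ('x \<Rightarrow> nat) \<Rightarrow> 'x rel
    \<Rightarrow> (('x multiset \<Rightarrow>\<^sub>0 'k) \<Rightarrow> ('x multiset \<Rightarrow>\<^sub>0 'k::comm_ring_1)) \<Rightarrow> bool" where
  "degenerates_at_E2 X deg r d \<longleftrightarrow> (\<forall>p q. hh_E X deg r d 2 p q = hh_E_infinity X deg r d p q)"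

end

theory Submission
  imports Defs "HOL-Library.Nat_Bijection"
begin

text \<open>
  We use a single model of \<open>k\<close>. It has one generator \<open>s m\<close> for every monomial \<open>m\<close>, so that
  \<open>m \<mapsto> s m\<close> is a contraction \<open>h\<close> of the augmentation ideal. Its generators of lowest degree are
  \<open>y = s 1\<close> and \<open>x = s y\<close>, of degrees 1 and 2, with \<open>\<partial>x = y\<close>. The class
  \<open>c = 1 \<otimes> y \<otimes> \<dots> \<otimes> y\<close> in bidegree \<open>(n, n)\<close> is the divided power \<open>\<gamma>\<^sub>n(dy)\<close>.

  The elements \<open>x\<^sub>0 = 1\<close>, \<open>x\<^sub>j\<^sub>+\<^sub>1 = h (y x\<^sub>j)\<close> satisfy \<open>\<partial>x\<^sub>j\<^sub>+\<^sub>1 = y x\<^sub>j\<close>, as divided powers of \<open>x\<close>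
  would. If \<open>z\<^sub>j\<close> are the coefficients of the inverse of the power series \<open>\<Sum>\<^sub>j x\<^sub>j t\<^sup>j\<close>, then, up to
  signs, \<open>c\<close> is the total boundary of the sum of all \<open>x\<^sub>j\<^sub>-\<^sub>i \<otimes> y \<otimes> \<dots> \<otimes> y \<otimes> z\<^sub>i\<close> with \<open>n - j\<close>
  factors \<open>y\<close> and \<open>1 \<le> i \<le> j \<le> n\<close>, so it vanishes in \<open>E\<^sup>\<infinity>\<close>.

  On the other hand, \<open>C\<^sub>n\<^sub>+\<^sub>1\<^sub>,\<^sub>n\<close> is spanned by
  \<open>y \<otimes> y \<otimes> \<dots> \<otimes> y\<close> and the elements \<open>1 \<otimes> y \<otimes> \<dots> \<otimes> x \<otimes> \<dots> \<otimes> y\<close>; the cycles for \<open>b\<close>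
  in it have alternating coefficients along the latter, so \<open>\<partial>\<close> sends them to multiples of \<open>n c\<close>.
  Hence \<open>c\<close> vanishes in \<open>E\<^sup>2\<close> only if \<open>n\<close> is invertible.
\<close>

section \<open>Linear maps between free modules\<close>

abbreviation lookup where "lookup \<equiv> Poly_Mapping.lookup"
abbreviation keys where "keys \<equiv> Poly_Mapping.keys"
abbreviation single where "single \<equiv> Poly_Mapping.single"

text \<open>\<open>{#}\<close> is the zero of multisets, so this rule would rewrite the basis
  element \<open>single {#} 1\<close> to \<open>1\<close>, a form that the rules for
  \<open>single\<close> do not match.\<close>

declare single_one [simp del]

definition linear_map :: "(('b \<Rightarrow>\<^sub>0 'k::comm_ring_1) \<Rightarrow> ('c \<Rightarrow>\<^sub>0 'k)) \<Rightarrow> bool" where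
  "linear_map F \<longleftrightarrow> (\<forall>f g. F (f + g) = F f + F g) \<and> (\<forall>c f. F (pscale c f) = pscale c (F f))"

named_theorems linear_intros

lemma linear_mapI:
  "\<lbrakk>\<And>f g. F (f + g) = F f + F g; \<And>c f. F (pscale c f) = pscale c (F f)\<rbrakk> \<Longrightarrow> linear_map F"
  by (simp add: linear_map_def)

lemma linear_map_add: "linear_map F \<Longrightarrow> F (f + g) = F f + F g"
  by (simp add: linear_map_def)

lemma linear_map_pscale: "linear_map F \<Longrightarrow> F (pscale c f) = pscale c (F f)"
  by (simp add: linear_map_def)

lemma lookup_pscale [simp]: "lookup (pscale c f) m = c * lookup f m"
  by (simp add: pscale_def Poly_Mapping.map.rep_eq when_def)

lemma pscale_simps [simp]:
  "pscale 0 f = 0" "pscale 1 f = f" "pscale c 0 = 0" "pscale (-1) f = - f"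
  "pscale c (pscale c' f) = pscale (c * c') f" "pscale c (- f) = pscale (- c) f"
  "pscale c (single m c') = single m (c * c')"
  by (auto intro!: poly_mapping_eqI simp: mult.assoc lookup_single when_def)

lemma pscale_add_right: "pscale c (f + g) = pscale c f + pscale c g"
  by (rule poly_mapping_eqI) (simp add: lookup_add algebra_simps)

lemma pscale_add_left: "pscale (c + c') f = pscale c f + pscale c' f"
  by (rule poly_mapping_eqI) (simp add: lookup_add algebra_simps)

lemma pscale_diff_right: "pscale c (f - g) = pscale c f - pscale c g"
  by (rule poly_mapping_eqI) (simp add: lookup_minus right_diff_distrib)

lemma pscale_minus_left: "pscale (- c) f = - pscale c f"
  by (auto intro!: poly_mapping_eqI)

lemma pscale_sum: "pscale c (\<Sum>i\<in>I. f i) = (\<Sum>i\<in>I. pscale c (f i))"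
  by (induction I rule: infinite_finite_induct) (simp_all add: pscale_add_right)

lemma linear_map_0: "linear_map F \<Longrightarrow> F 0 = 0"
  using linear_map_pscale[of F 0 0] by simp

lemma linear_map_uminus: "linear_map F \<Longrightarrow> F (- f) = - F f"
  using linear_map_pscale[of F "-1" f] by simp

lemma linear_map_diff: "linear_map F \<Longrightarrow> F (f - g) = F f - F g"
  using linear_map_add[of F f "- g"] linear_map_uminus[of F g] by simp

lemma linear_map_sum: "linear_map F \<Longrightarrow> F (\<Sum>i\<in>I. f i) = (\<Sum>i\<in>I. F (f i))"
  by (induction I rule: infinite_finite_induct) (simp_all add: linear_map_add linear_map_0)

text \<open>Supports may shrink when elements are added, so sums over them are compared over a
  common finite superset.\<close>

lemma lin_ext_superset:
  assumes "finite S" "keys f \<subseteq> S"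
  shows "lin_ext \<phi> f = (\<Sum>m\<in>S. pscale (lookup f m) (\<phi> m))"
  unfolding lin_ext_def using assms
  by (intro sum.mono_neutral_left) (auto simp: in_keys_iff)

lemma linear_lin_ext: "linear_map (lin_ext \<phi>)"
proof (rule linear_mapI)
  fix f g :: "'a \<Rightarrow>\<^sub>0 'b" and c :: 'b
  let ?S = "keys f \<union> keys g"
  have "keys (f + g) \<subseteq> ?S" by (rule keys_add)
  then show "lin_ext \<phi> (f + g) = lin_ext \<phi> f + lin_ext \<phi> g"
    by (simp add: lin_ext_superset[of ?S] lookup_add pscale_add_left sum.distrib)
  have "keys (pscale c f) \<subseteq> keys f" by (auto simp: in_keys_iff)
  then show "lin_ext \<phi> (pscale c f) = pscale c (lin_ext \<phi> f)"
    by (simp add: lin_ext_superset[of "keys f"] pscale_sum)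
qed

lemma lin_ext_single [simp]: "lin_ext \<phi> (single m c) = pscale c (\<phi> m)"
  using lin_ext_superset[of "{m}" "single m c" \<phi>] by simp

lemma lin_ext_cong: "(\<And>m. m \<in> keys f \<Longrightarrow> \<phi> m = \<psi> m) \<Longrightarrow> lin_ext \<phi> f = lin_ext \<psi> f"
  by (simp add: lin_ext_def)

lemma lin_ext_single_one: "lin_ext (\<lambda>m. single m 1) f = f"
  by (rule poly_mapping_eqI)
    (auto simp: lin_ext_def lookup_sum lookup_single when_def in_keys_iff)

lemma linear_map_expand:
  assumes "linear_map F" shows "F f = lin_ext (\<lambda>m. F (single m 1)) f"
proof -
  have "F f = F (\<Sum>m\<in>keys f. pscale (lookup f m) (single m 1))"
    using lin_ext_single_one[of f] by (simp add: lin_ext_def)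
  then show ?thesis
    by (simp only: linear_map_sum[OF assms] linear_map_pscale[OF assms] lin_ext_def)
qed

text \<open>Basis elements need testing only inside the support of \<open>f\<close>, so an identity
  that holds for monomials of a given degree, or for those in \<open>monomials X deg\<close>,
  extends to the elements they span.\<close>

lemma linear_map_eqI:
  assumes "linear_map F" "linear_map G" "\<And>m. m \<in> keys f \<Longrightarrow> F (single m 1) = G (single m 1)"
  shows "F f = G f"
  using assms(3) linear_map_expand[OF assms(1), of f] linear_map_expand[OF assms(2), of f]
  by (simp cong: lin_ext_cong)

lemma keys_pscale: "keys (pscale c f) \<subseteq> keys f"
  by (auto simp: in_keys_iff)

lemma keys_sum_subset: "keys (\<Sum>i\<in>I. f i) \<subseteq> (\<Union>i\<in>I. keys (f i))"
proof (induction I rule: infinite_finite_induct)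
  case (insert i I)
  then show ?case using keys_add[of "f i" "sum f I"] by auto
qed auto

lemma keys_diff: "keys (f - g) \<subseteq> keys f \<union> keys (g :: 'b \<Rightarrow>\<^sub>0 'k::ab_group_add)"
  by (auto simp: in_keys_iff lookup_minus)

lemma keys_lin_ext: "keys (lin_ext \<phi> f) \<subseteq> (\<Union>m\<in>keys f. keys (\<phi> m))"
  unfolding lin_ext_def using keys_sum_subset keys_pscale by fastforce

lemma linear_ident [linear_intros]: "linear_map (\<lambda>f. f)"
  by (rule linear_mapI) auto

lemma linear_zero [linear_intros]: "linear_map (\<lambda>f. 0)"
  by (rule linear_mapI) auto

lemma linear_add [linear_intros]:
  "\<lbrakk>linear_map F; linear_map G\<rbrakk> \<Longrightarrow> linear_map (\<lambda>f. F f + G f)"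
  by (rule linear_mapI) (auto simp: linear_map_def pscale_add_right)

lemma linear_pscale [linear_intros]: "linear_map F \<Longrightarrow> linear_map (\<lambda>f. pscale c (F f))"
  by (rule linear_mapI) (auto simp: linear_map_def pscale_add_right mult.commute)

lemma linear_minus [linear_intros]:
  "\<lbrakk>linear_map F; linear_map G\<rbrakk> \<Longrightarrow> linear_map (\<lambda>f. F f - G f)"
  by (rule linear_mapI) (auto simp: linear_map_def pscale_diff_right)

lemma linear_compose:
  "\<lbrakk>linear_map F; linear_map G\<rbrakk> \<Longrightarrow> linear_map (\<lambda>f. F (G f))"
  by (rule linear_mapI) (auto simp: linear_map_def)

lemma linear_lin_ext_compose [linear_intros]:
  "linear_map F \<Longrightarrow> linear_map (\<lambda>f. lin_ext \<phi> (F f))"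
  by (rule linear_compose[OF linear_lin_ext])

text \<open>Gives linearity in the second argument of bilinear maps built from nested
  \<open>lin_ext\<close>, namely \<open>lam_mul\<close> and later \<open>T\<close>.\<close>

lemma linear_lin_ext_arg:
  assumes "\<And>m. linear_map (\<lambda>f. G m f)"
  shows "linear_map (\<lambda>f. lin_ext (\<lambda>m. G m f) g)"
proof (rule linear_mapI)
  fix f f' c
  show "lin_ext (\<lambda>m. G m (f + f')) g = lin_ext (\<lambda>m. G m f) g + lin_ext (\<lambda>m. G m f') g"
    by (simp add: lin_ext_def linear_map_add[OF assms] pscale_add_right sum.distrib)
  show "lin_ext (\<lambda>m. G m (pscale c f)) g = pscale c (lin_ext (\<lambda>m. G m f) g)"
    by (simp add: lin_ext_def linear_map_pscale[OF assms] pscale_sum mult.commute)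
qed

lemma keys_linear_map:
  assumes "linear_map F" "\<And>m. m \<in> keys f \<Longrightarrow> keys (F (single m 1)) \<subseteq> S"
  shows "keys (F f) \<subseteq> S"
  using keys_lin_ext[of "\<lambda>m. F (single m 1)" f] assms(2) linear_map_expand[OF assms(1), of f]
  by auto

lemma module_pscale: "module (pscale :: 'k::comm_ring_1 \<Rightarrow> ('b \<Rightarrow>\<^sub>0 'k) \<Rightarrow> _)"
  by standard (simp_all add: pscale_add_right pscale_add_left)

lemma neg_one_power_cong: "even a = even b \<Longrightarrow> (-1 :: 'k::comm_ring_1) ^ a = (-1) ^ b"
  by (metis neg_one_even_power neg_one_odd_power)

section \<open>Multiplication in a free graded commutative algebra\<close>

definition odds :: "('x \<Rightarrow> nat) \<Rightarrow> 'x multiset \<Rightarrow> 'x set" where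
  "odds deg m = {x. x \<in># m \<and> odd (deg x)}"

text \<open>The exponent of the sign in \<open>mono_mul\<close>. It sees only the sets of odd
  factors, so it is additive in an argument as long as the two summands there do not clash.\<close>

definition inversions :: "('x \<Rightarrow> nat) \<Rightarrow> 'x rel \<Rightarrow> 'x multiset \<Rightarrow> 'x multiset \<Rightarrow> nat" where
  "inversions deg r m m' = card {(x, y) \<in> odds deg m \<times> odds deg m'. (y, x) \<in> r \<and> y \<noteq> x}"

definition clash :: "('x \<Rightarrow> nat) \<Rightarrow> 'x multiset \<Rightarrow> 'x multiset \<Rightarrow> bool" where
  "clash deg m m' \<longleftrightarrow> odds deg m \<inter> odds deg m' \<noteq> {}"

definition homog :: "'x set \<Rightarrow> ('x \<Rightarrow> nat) \<Rightarrow> nat \<Rightarrow> ('x multiset \<Rightarrow>\<^sub>0 'k::comm_ring_1) set" where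
  "homog X deg n = {f. keys f \<subseteq> {m \<in> monomials X deg. mdeg deg m = n}}"

lemma mono_mul_alt:
  "mono_mul deg r m m' =
     (if clash deg m m' then 0 else single (m + m') ((-1) ^ inversions deg r m m'))"
proof -
  have "{(x, y). x \<in># m \<and> y \<in># m' \<and> odd (deg x) \<and> odd (deg y) \<and> (y, x) \<in> r \<and> y \<noteq> x}
      = {(x, y) \<in> odds deg m \<times> odds deg m'. (y, x) \<in> r \<and> y \<noteq> x}"
    by (auto simp: odds_def)
  moreover have "(\<exists>x. x \<in># m \<and> x \<in># m' \<and> odd (deg x)) \<longleftrightarrow> clash deg m m'"
    by (auto simp: clash_def odds_def)
  ultimately show ?thesis by (simp add: mono_mul_def inversions_def)
qed

lemma finite_odds [simp]: "finite (odds deg m)"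
  by (rule finite_subset[of _ "set_mset m"]) (auto simp: odds_def)

lemma odds_add [simp]: "odds deg (m + m') = odds deg m \<union> odds deg m'"
  by (auto simp: odds_def)

lemma odds_empty [simp]: "odds deg {#} = {}"
  by (simp add: odds_def)

lemma clash_sym: "clash deg m m' \<longleftrightarrow> clash deg m' m"
  by (auto simp: clash_def)

lemma clash_add [simp]:
  "clash deg (m + m') n \<longleftrightarrow> clash deg m n \<or> clash deg m' n"
  "clash deg n (m + m') \<longleftrightarrow> clash deg n m \<or> clash deg n m'"
  "clash deg (add_mset x m) n \<longleftrightarrow> odd (deg x) \<and> x \<in># n \<or> clash deg m n"
  "clash deg n (add_mset x m) \<longleftrightarrow> odd (deg x) \<and> x \<in># n \<or> clash deg n m"
  by (auto simp: clash_def odds_def)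

lemma clash_empty [simp]: "\<not> clash deg {#} m" "\<not> clash deg m {#}"
  by (auto simp: clash_def)

lemma inversions_add_left:
  assumes "\<not> clash deg m m'"
  shows "inversions deg r (m + m') n = inversions deg r m n + inversions deg r m' n"
proof -
  let ?I = "\<lambda>m. {(x, y) \<in> odds deg m \<times> odds deg n. (y, x) \<in> r \<and> y \<noteq> x}"
  have fin: "finite (?I m)" for m
    by (rule finite_subset[of _ "odds deg m \<times> odds deg n"]) auto
  have "?I (m + m') = ?I m \<union> ?I m'" by auto
  moreover have "?I m \<inter> ?I m' = {}" using assms by (auto simp: clash_def)
  ultimately show ?thesis
    using card_Un_disjoint[OF fin fin] by (simp add: inversions_def)
qed

lemma inversions_add_right:
  assumes "\<not> clash deg m m'"
  shows "inversions deg r n (m + m') = inversions deg r n m + inversions deg r n m'"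
proof -
  let ?I = "\<lambda>m. {(x, y) \<in> odds deg n \<times> odds deg m. (y, x) \<in> r \<and> y \<noteq> x}"
  have fin: "finite (?I m)" for m
    by (rule finite_subset[of _ "odds deg n \<times> odds deg m"]) auto
  have "?I (m + m') = ?I m \<union> ?I m'" by auto
  moreover have "?I m \<inter> ?I m' = {}" using assms by (auto simp: clash_def)
  ultimately show ?thesis
    using card_Un_disjoint[OF fin fin] by (simp add: inversions_def)
qed

lemma inversions_empty [simp]: "inversions deg r {#} m = 0" "inversions deg r m {#} = 0"
  by (simp_all add: inversions_def)

text \<open>As \<open>r\<close> is total and antisymmetric on \<open>X\<close>, a pair of distinct
  odd factors, one of \<open>m\<close> and one of \<open>m'\<close>, is an inversion in exactly one
  of the two orders.\<close>

lemma inversions_swap: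
  assumes "linear_order_on X r" "set_mset m \<subseteq> X" "set_mset m' \<subseteq> X" "\<not> clash deg m m'"
  shows "inversions deg r m m' + inversions deg r m' m = card (odds deg m) * card (odds deg m')"
proof -
  let ?A = "odds deg m" and ?B = "odds deg m'"
  let ?I = "{(x, y) \<in> ?A \<times> ?B. (y, x) \<in> r \<and> y \<noteq> x}"
  let ?J = "{(x, y) \<in> ?A \<times> ?B. (x, y) \<in> r \<and> x \<noteq> y}"
  let ?J' = "{(x, y) \<in> ?B \<times> ?A. (y, x) \<in> r \<and> y \<noteq> x}"
  have "?J = prod.swap ` ?J'" by (auto simp: image_iff)
  then have J: "card ?J = card ?J'" by (simp add: card_image)
  have sub: "?A \<subseteq> X" "?B \<subseteq> X" "?A \<inter> ?B = {}"
    using assms by (auto simp: odds_def clash_def)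
  have r: "total_on X r" "antisym r"
    using assms(1) by (auto simp: linear_order_on_def partial_order_on_def)
  have "finite ?I" "finite ?J" by (rule finite_subset[of _ "?A \<times> ?B"]; auto)+
  moreover have "?I \<inter> ?J = {}" using r(2) by (auto simp: antisym_def)
  moreover have "?I \<union> ?J = ?A \<times> ?B"
    using sub r(1) by (fastforce simp: total_on_def)
  ultimately show ?thesis
    using card_Un_disjoint[of ?I ?J] J by (simp add: inversions_def card_cartesian_product)
qed

lemma mdeg_simps [simp]:
  "mdeg deg {#} = 0" "mdeg deg (add_mset x m) = deg x + mdeg deg m"
  "mdeg deg (m + m') = mdeg deg m + mdeg deg m'"
  by (simp_all add: mdeg_def)

lemma empty_monomial [simp]: "{#} \<in> monomials X deg"
  by (simp add: monomials_def)

lemma single_monomial [simp]: "{#x#} \<in> monomials X deg \<longleftrightarrow> x \<in> X"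
  by (simp add: monomials_def)

lemma monomials_add:
  "\<lbrakk>m \<in> monomials X deg; m' \<in> monomials X deg; \<not> clash deg m m'\<rbrakk> \<Longrightarrow> m + m' \<in> monomials X deg"
  unfolding monomials_def clash_def odds_def
  by (auto simp: count_eq_zero_iff)

lemma monomials_add_mset:
  "add_mset x m \<in> monomials X deg \<longleftrightarrow> x \<in> X \<and> m \<in> monomials X deg \<and> \<not> clash deg {#x#} m"
  (is "?L \<longleftrightarrow> ?R")
proof
  assume L: ?L
  have "count m y = 1" if "y \<in># m" "odd (deg y)" for y
  proof (cases "y = x")
    case True
    with L have "count (add_mset x m) x = 1" "x \<in># m" using that by (auto simp: monomials_def)
    then show ?thesis by (simp add: count_eq_zero_iff)
  next
    case False
    with L have "count (add_mset x m) y = 1" using that by (auto simp: monomials_def)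
    with False show ?thesis by simp
  qed
  moreover have "\<not> (x \<in># m \<and> odd (deg x))"
    using L by (auto simp: monomials_def not_in_iff)
  ultimately show ?R using L by (auto simp: monomials_def clash_def odds_def)
next
  assume ?R
  then show ?L using monomials_add[of "{#x#}" X deg m] by simp
qed

lemma monomials_subset: "m \<in> monomials X deg \<Longrightarrow> set_mset m \<subseteq> X"
  by (simp add: monomials_def)

text \<open>Only odd generators affect the parity of the degree, and each of them occurs at most
  once. This links signs given by degrees to signs given by inversions.\<close>

lemma even_mdeg_iff:
  "m \<in> monomials X deg \<Longrightarrow> even (mdeg deg m) \<longleftrightarrow> even (card (odds deg m))"
proof (induction m)
  case (add x m)
  then have m: "m \<in> monomials X deg" and cl: "\<not> clash deg {#x#} m"
    by (auto simp: monomials_add_mset)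
  show ?case
  proof (cases "odd (deg x)")
    case True
    then have "odds deg (add_mset x m) = insert x (odds deg m)" "x \<notin> odds deg m"
      using cl by (auto simp: odds_def)
    then show ?thesis using add.IH[OF m] True by simp
  next
    case False
    then have "odds deg (add_mset x m) = odds deg m" by (auto simp: odds_def)
    then show ?thesis using add.IH[OF m] False by simp
  qed
qed simp

lemma inversions_swap_parity:
  assumes "linear_order_on X r" "m \<in> monomials X deg" "m' \<in> monomials X deg" "\<not> clash deg m m'"
  shows "even (inversions deg r m m' + inversions deg r m' m) \<longleftrightarrow> even (mdeg deg m * mdeg deg m')"
  using inversions_swap[of X r m m' deg] assms even_mdeg_iff[of _ X deg]
  by (simp add: monomials_subset)

lemma lam_mul_single [simp]:
  "lam_mul deg r (single m a) (single m' b) = pscale (a * b) (mono_mul deg r m m')"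
  by (simp add: lam_mul_def)

lemma linear_lam_mul_left: "linear_map (\<lambda>f. lam_mul deg r f g)"
  unfolding lam_mul_def by (rule linear_lin_ext)

lemma linear_lam_mul_right: "linear_map (lam_mul deg r f)"
  unfolding lam_mul_def by (intro linear_lin_ext_arg linear_lin_ext)

lemma linear_lam_mul_compose [linear_intros]:
  "linear_map F \<Longrightarrow> linear_map (\<lambda>f. lam_mul deg r (F f) g)"
  "linear_map F \<Longrightarrow> linear_map (\<lambda>f. lam_mul deg r g (F f))"
  by (rule linear_compose[OF linear_lam_mul_left] linear_compose[OF linear_lam_mul_right];
      assumption)+

lemmas lam_mul_pscale [simp] =
  linear_map_pscale[OF linear_lam_mul_left] linear_map_pscale[OF linear_lam_mul_right]
lemmas lam_mul_zero [simp] =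
  linear_map_0[OF linear_lam_mul_left] linear_map_0[OF linear_lam_mul_right]
lemmas lam_mul_minus [simp] =
  linear_map_uminus[OF linear_lam_mul_left] linear_map_uminus[OF linear_lam_mul_right]
lemmas lam_mul_add =
  linear_map_add[OF linear_lam_mul_left] linear_map_add[OF linear_lam_mul_right]
lemmas lam_mul_sum =
  linear_map_sum[OF linear_lam_mul_left] linear_map_sum[OF linear_lam_mul_right]

text \<open>Both exponents count the inversions of the three pairs among \<open>m\<close>,
  \<open>m'\<close>, \<open>n\<close>, and both sides vanish as soon as one pair clashes.\<close>

lemma lam_mul_mono_assoc:
  fixes m m' n :: "'x multiset"
  shows "lam_mul deg r (mono_mul deg r m m') (single n 1)
     = lam_mul deg r (single m 1) (mono_mul deg r m' n :: _ \<Rightarrow>\<^sub>0 'k::comm_ring_1)"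
proof (cases "clash deg m m' \<or> clash deg m n \<or> clash deg m' n")
  case True
  then show ?thesis by (auto simp: mono_mul_alt)
next
  case False
  then have "(-1 :: 'k) ^ inversions deg r m m' * (-1) ^ inversions deg r (m + m') n
      = (-1) ^ inversions deg r m' n * (-1) ^ inversions deg r m (m' + n)"
    by (simp add: inversions_add_left inversions_add_right flip: power_add)
      (simp add: ac_simps)
  moreover have "lam_mul deg r (mono_mul deg r m m') (single n (1 :: 'k)) = single (m + m' + n)
      ((-1) ^ inversions deg r m m' * (-1) ^ inversions deg r (m + m') n)"
    using False by (simp add: mono_mul_alt)
  moreover have "lam_mul deg r (single m (1 :: 'k)) (mono_mul deg r m' n) = single (m + (m' + n))
      ((-1) ^ inversions deg r m' n * (-1) ^ inversions deg r m (m' + n))"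
    using False by (simp add: mono_mul_alt)
  ultimately show ?thesis by (simp only: add.assoc)
qed

lemma lam_mul_assoc:
  "lam_mul deg r (lam_mul deg r f g) h = lam_mul deg r f (lam_mul deg r g h)"
proof (rule linear_map_eqI[of "\<lambda>f. lam_mul deg r (lam_mul deg r f g) h"])
  fix m
  show "lam_mul deg r (lam_mul deg r (single m 1) g) h
      = lam_mul deg r (single m 1) (lam_mul deg r g h)"
  proof (rule linear_map_eqI[of "\<lambda>g. lam_mul deg r (lam_mul deg r (single m 1) g) h"])
    fix m'
    show "lam_mul deg r (lam_mul deg r (single m 1) (single m' 1)) h
        = lam_mul deg r (single m 1) (lam_mul deg r (single m' 1) h)"
      by (rule linear_map_eqI[of "\<lambda>h. lam_mul deg r (lam_mul deg r (single m 1) (single m' 1)) h"])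
        (auto intro!: linear_intros simp: lam_mul_mono_assoc)
  qed (intro linear_intros)+
qed (intro linear_intros)+

lemma lam_mul_one [simp]:
  "lam_mul deg r (single {#} 1) f = f" "lam_mul deg r f (single {#} 1) = f"
  by (rule linear_map_eqI[of "lam_mul deg r (single {#} 1)" "\<lambda>f. f"],
      auto intro!: linear_intros simp: mono_mul_alt)
    (rule linear_map_eqI[of "\<lambda>f. lam_mul deg r f (single {#} 1)" "\<lambda>f. f"],
      auto intro!: linear_intros simp: mono_mul_alt)

section \<open>Homogeneous elements and graded commutativity\<close>

lemma homog_lookupD: "\<lbrakk>f \<in> homog X deg n; m \<in> keys f\<rbrakk> \<Longrightarrow> m \<in> monomials X deg \<and> mdeg deg m = n"
  by (auto simp: homog_def)

lemma single_homog: "\<lbrakk>m \<in> monomials X deg; mdeg deg m = n\<rbrakk> \<Longrightarrow> single m c \<in> homog X deg n"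
  by (simp add: homog_def)

lemma homog_zero [simp]: "0 \<in> homog X deg n"
  by (simp add: homog_def)

lemma homog_pscale: "f \<in> homog X deg n \<Longrightarrow> pscale c f \<in> homog X deg n"
  using keys_pscale[of c f] by (auto simp: homog_def)

lemma homog_uminus: "f \<in> homog X deg n \<Longrightarrow> - f \<in> homog X deg n"
  using homog_pscale[of f X deg n "-1"] by simp

lemma homog_add: "\<lbrakk>f \<in> homog X deg n; g \<in> homog X deg n\<rbrakk> \<Longrightarrow> f + g \<in> homog X deg n"
  using keys_add[of f g] by (auto simp: homog_def)

lemma homog_diff: "\<lbrakk>f \<in> homog X deg n; g \<in> homog X deg n\<rbrakk> \<Longrightarrow> f - g \<in> homog X deg n"
  using keys_diff[of f g] by (auto simp: homog_def)

lemma homog_sum: "(\<And>i. i \<in> I \<Longrightarrow> f i \<in> homog X deg n) \<Longrightarrow> (\<Sum>i\<in>I. f i) \<in> homog X deg n"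
  by (induction I rule: infinite_finite_induct) (auto intro: homog_add)

lemma homog_linear_map:
  assumes "linear_map F" "\<And>m. m \<in> keys f \<Longrightarrow> F (single m 1) \<in> homog X deg n"
  shows "F f \<in> homog X deg n"
  using keys_linear_map[OF assms(1), of f] assms(2) by (auto simp: homog_def)

lemma mono_mul_homog:
  "\<lbrakk>m \<in> monomials X deg; m' \<in> monomials X deg\<rbrakk>
    \<Longrightarrow> mono_mul deg r m m' \<in> homog X deg (mdeg deg m + mdeg deg m')"
  by (auto simp: mono_mul_alt intro!: single_homog monomials_add)

lemma homog_lam_mul:
  assumes "f \<in> homog X deg p" "g \<in> homog X deg q"
  shows "lam_mul deg r f g \<in> homog X deg (p + q)"
proof (rule homog_linear_map[of "\<lambda>f. lam_mul deg r f g"])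
  fix m assume m: "m \<in> keys f"
  show "lam_mul deg r (single m 1) g \<in> homog X deg (p + q)"
    by (rule homog_linear_map[of "lam_mul deg r (single m 1)"])
      (use mono_mul_homog[of m X deg _ r] homog_lookupD[OF assms(1) m] homog_lookupD[OF assms(2)]
        in \<open>auto intro!: linear_intros\<close>)
qed (intro linear_intros)

lemma mono_mul_commute:
  fixes m m' :: "'x multiset"
  assumes "linear_order_on X r" "m \<in> monomials X deg" "m' \<in> monomials X deg"
  shows "(mono_mul deg r m' m :: _ \<Rightarrow>\<^sub>0 'k::comm_ring_1)
     = pscale ((-1) ^ (mdeg deg m * mdeg deg m')) (mono_mul deg r m m')"
proof (cases "clash deg m m'")
  case False
  have "(-1 :: 'k) ^ inversions deg r m' m
      = (-1) ^ (mdeg deg m * mdeg deg m' + inversions deg r m m')"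
    by (rule neg_one_power_cong) (use inversions_swap_parity[OF assms False] in auto)
  with False show ?thesis
    by (simp add: mono_mul_alt clash_sym[of deg m' m] add.commute power_add mult.commute)
qed (simp add: mono_mul_alt clash_sym[of deg m' m])

lemma lam_mul_commute:
  assumes "linear_order_on X r" "f \<in> homog X deg p" "g \<in> homog X deg q"
  shows "lam_mul deg r g f = pscale ((-1) ^ (p * q)) (lam_mul deg r f g)"
proof (rule linear_map_eqI[where f = f])
  fix m assume m: "m \<in> keys f"
  show "lam_mul deg r g (single m 1) = pscale ((-1) ^ (p * q)) (lam_mul deg r (single m 1) g)"
    by (rule linear_map_eqI[where f = g])
      (use mono_mul_commute[OF assms(1), of m deg, where 'k = 'b] homog_lookupD[OF assms(2) m]
        homog_lookupD[OF assms(3)] in \<open>auto intro!: linear_intros\<close>)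
qed (intro linear_intros)+

text \<open>Skew symmetry would only give \<open>B f f + B f f = 0\<close>, which is too weak when 2
  is not invertible; hence the separate hypothesis on the diagonal. The induction splits off one
  basis element, and the mixed terms cancel.\<close>

lemma alternating_zero:
  assumes lin: "\<And>g. linear_map (\<lambda>f. B f g)" "\<And>f. linear_map (B f)"
    and alt: "\<And>m. m \<in> S \<Longrightarrow> B (single m 1) (single m 1) = 0"
      "\<And>m m'. \<lbrakk>m \<in> S; m' \<in> S\<rbrakk> \<Longrightarrow> B (single m 1) (single m' 1) + B (single m' 1) (single m 1) = 0"
    and S: "keys f \<subseteq> S"
  shows "B f f = 0"
proof -
  have "B f f = 0" if "finite K" "K \<subseteq> S" "keys f \<subseteq> K" for K f
    using that
  proof (induction K arbitrary: f)
    case empty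
    then show ?case using linear_map_0[OF lin(2)] by simp
  next
    case (insert k K)
    let ?e = "single k 1"
    define c g where "c = lookup f k" and "g = f - single k c"
    have f: "f = pscale c ?e + g" by (simp add: g_def)
    have K: "keys g \<subseteq> K"
      using insert.prems(2) insert.hyps(2)
      by (auto simp: g_def c_def in_keys_iff lookup_minus lookup_single when_def split: if_splits)
    have mix: "B g ?e + B ?e g = 0"
      by (rule linear_map_eqI[of "\<lambda>g. B g ?e + B ?e g" "\<lambda>g. 0"])
        (use K insert.prems(1) in \<open>auto intro!: linear_intros lin alt(2)\<close>)
    have gg: "B g g = 0" using K insert by auto
    have ee: "B ?e ?e = 0" using insert.prems(1) alt(1) by auto
    have "B f f = B (pscale c ?e + g) (pscale c ?e + g)"
      by (simp only: f[symmetric])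
    then have "B f f = pscale c (pscale c (B ?e ?e)) + pscale c (B g ?e + B ?e g) + B g g"
      by (simp only: linear_map_add[OF lin(1)] linear_map_add[OF lin(2)] linear_map_pscale[OF lin(1)]
          linear_map_pscale[OF lin(2)] pscale_add_right add.assoc)
    then show ?case by (simp only: mix gg ee pscale_simps add_0_left)
  qed
  from this[of "keys f" f] show ?thesis using S by simp
qed

lemma lam_mul_odd_square:
  fixes f :: "'x multiset \<Rightarrow>\<^sub>0 'k::comm_ring_1"
  assumes "linear_order_on X r" "f \<in> homog X deg n" "odd n"
  shows "lam_mul deg r f f = 0"
proof (rule alternating_zero[where B = "lam_mul deg r" and S = "{m \<in> monomials X deg. mdeg deg m = n}"])
  fix m assume m: "m \<in> {m \<in> monomials X deg. mdeg deg m = n}"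
  then have "odds deg m \<noteq> {}" using even_mdeg_iff[of m X deg] assms(3) by auto
  then show "lam_mul deg r (single m 1) (single m (1::'k)) = 0"
    by (simp add: mono_mul_alt clash_def)
next
  fix m m'
  assume "m \<in> {m \<in> monomials X deg. mdeg deg m = n}" "m' \<in> {m \<in> monomials X deg. mdeg deg m = n}"
  then show "lam_mul deg r (single m 1) (single m' (1::'k))
      + lam_mul deg r (single m' 1) (single m 1) = 0"
    using mono_mul_commute[OF assms(1), of m deg m', where 'k = 'k] assms(3) by simp
qed (use assms in \<open>auto simp: homog_def intro: linear_intros\<close>)

section \<open>Derivations of a free graded commutative algebra\<close>

text \<open>The monomial \<open>add_mset x m\<close> equals \<open>x\<close> times \<open>m\<close>
  up to the sign of sorting \<open>x\<close> into \<open>m\<close>; this is that product with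
  \<open>x\<close> replaced by \<open>\<delta> x\<close>.\<close>

definition der_term ::
  "('x \<Rightarrow> nat) \<Rightarrow> 'x rel \<Rightarrow> ('x \<Rightarrow> ('x multiset \<Rightarrow>\<^sub>0 'k)) \<Rightarrow> 'x \<Rightarrow> 'x multiset
    \<Rightarrow> ('x multiset \<Rightarrow>\<^sub>0 'k::comm_ring_1)" where
  "der_term deg r \<delta> x m =
     pscale ((-1) ^ inversions deg r {#x#} m) (lam_mul deg r (\<delta> x) (single m 1))"

text \<open>The factor \<open>count m x\<close> exceeds 1 only for even \<open>x\<close>, where it
  is the exponent in the derivative of a power.\<close>

definition der_mono ::
  "('x \<Rightarrow> nat) \<Rightarrow> 'x rel \<Rightarrow> ('x \<Rightarrow> ('x multiset \<Rightarrow>\<^sub>0 'k)) \<Rightarrow> 'x multiset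
    \<Rightarrow> ('x multiset \<Rightarrow>\<^sub>0 'k::comm_ring_1)" where
  "der_mono deg r \<delta> m =
     (\<Sum>x\<in>set_mset m. pscale (of_nat (count m x)) (der_term deg r \<delta> x (m - {#x#})))"

definition der ::
  "('x \<Rightarrow> nat) \<Rightarrow> 'x rel \<Rightarrow> ('x \<Rightarrow> ('x multiset \<Rightarrow>\<^sub>0 'k))
    \<Rightarrow> ('x multiset \<Rightarrow>\<^sub>0 'k) \<Rightarrow> ('x multiset \<Rightarrow>\<^sub>0 'k::comm_ring_1)" where
  "der deg r \<delta> = lin_ext (der_mono deg r \<delta>)"

text \<open>Records that \<open>der_mono\<close> evaluates \<open>\<delta>\<close> only at the
  factors of \<open>m\<close>; the recursive definition of \<open>cone_bdry\<close> terminates for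
  this reason.\<close>

lemma der_mono_cong [fundef_cong]:
  "\<lbrakk>m = m'; \<And>x. x \<in># m' \<Longrightarrow> \<delta> x = \<delta>' x\<rbrakk> \<Longrightarrow> der_mono deg r \<delta> m = der_mono deg r \<delta>' m'"
  by (simp add: der_mono_def der_term_def)

lemma linear_der [linear_intros]: "linear_map F \<Longrightarrow> linear_map (\<lambda>f. der deg r \<delta> (F f))"
  unfolding der_def by (rule linear_intros)

lemma der_single [simp]: "der deg r \<delta> (single m c) = pscale c (der_mono deg r \<delta> m)"
  by (simp add: der_def)

lemmas linear_der' = linear_der[OF linear_ident]
lemmas der_pscale [simp] = linear_map_pscale[OF linear_der']
lemmas der_zero [simp] = linear_map_0[OF linear_der']
lemmas der_minus [simp] = linear_map_uminus[OF linear_der']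
lemmas der_add = linear_map_add[OF linear_der']
lemmas der_diff = linear_map_diff[OF linear_der']
lemmas der_sum = linear_map_sum[OF linear_der']

lemma der_mono_empty [simp]: "der_mono deg r \<delta> {#} = 0"
  by (simp add: der_mono_def)

lemma der_mono_generator [simp]: "der_mono deg r \<delta> {#x#} = \<delta> x"
  by (simp add: der_mono_def der_term_def)

text \<open>The hypotheses concern only the factors of \<open>m\<close>, so the lemma is available
  inside an induction on the degree, before \<open>\<delta>\<close> is known to be homogeneous on
  all generators.\<close>

lemma der_mono_homog_aux:
  assumes "m \<in> monomials X deg" "\<And>x. x \<in> X \<Longrightarrow> x \<in># m \<Longrightarrow> \<delta> x \<in> homog X deg (deg x - 1)"
    "\<And>x. x \<in> X \<Longrightarrow> x \<in># m \<Longrightarrow> deg x > 0"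
  shows "der_mono deg r \<delta> m \<in> homog X deg (mdeg deg m - 1)"
  unfolding der_mono_def der_term_def
proof (intro homog_sum homog_pscale)
  fix x assume "x \<in># m"
  then obtain n where n: "m = add_mset x n" using multi_member_split by metis
  have "lam_mul deg r (\<delta> x) (single n 1) \<in> homog X deg (deg x - 1 + mdeg deg n)"
    using assms by (intro homog_lam_mul single_homog) (auto simp: n monomials_add_mset)
  moreover have "deg x - 1 + mdeg deg n = mdeg deg m - 1"
    using assms(1) assms(3)[of x] by (simp add: n monomials_add_mset)
  ultimately show "lam_mul deg r (\<delta> x) (single (m - {#x#}) 1) \<in> homog X deg (mdeg deg m - 1)"
    by (simp add: n)
qed

locale free_gca =
  fixes X :: "'x set" and deg :: "'x \<Rightarrow> nat" and r :: "'x rel"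
    and \<delta> :: "'x \<Rightarrow> ('x multiset \<Rightarrow>\<^sub>0 'k::comm_ring_1)"
  assumes lin_ord: "linear_order_on X r"
    and deg_pos: "x \<in> X \<Longrightarrow> deg x > 0"
    and gen_bdry: "x \<in> X \<Longrightarrow> \<delta> x \<in> homog X deg (deg x - 1)"
begin

abbreviation mult (infixl "\<cdot>" 70) where "f \<cdot> g \<equiv> lam_mul deg r f g"
abbreviation mon :: "'x multiset \<Rightarrow> ('x multiset \<Rightarrow>\<^sub>0 'k)" where "mon m \<equiv> single m 1"
abbreviation \<tau> where "\<tau> \<equiv> der_term deg r \<delta>"
abbreviation dd where "dd \<equiv> der deg r \<delta>"
abbreviation dm where "dm \<equiv> der_mono deg r \<delta>"
abbreviation M where "M \<equiv> monomials X deg"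
abbreviation ndeg where "ndeg \<equiv> mdeg deg"
abbreviation inv where "inv \<equiv> inversions deg r"
abbreviation clsh where "clsh \<equiv> clash deg"

lemma mono_mul_pscale:
  "mono_mul deg r m n = (if clsh m n then 0 else pscale ((-1) ^ inv m n) (mon (m + n)))"
  by (simp add: mono_mul_alt)

lemma mon_commute_gen_bdry:
  assumes "m \<in> M" "x \<in> X"
  shows "mon m \<cdot> (\<delta> x \<cdot> f) = pscale ((-1) ^ (ndeg m * (deg x - 1))) (\<delta> x \<cdot> (mon m \<cdot> f))"
proof -
  have "mon m \<cdot> \<delta> x = pscale ((-1) ^ ((deg x - 1) * ndeg m)) (\<delta> x \<cdot> mon m)"
    by (rule lam_mul_commute[OF lin_ord gen_bdry[OF assms(2)] single_homog[OF assms(1) refl]])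
  then show ?thesis by (simp add: mult.commute flip: lam_mul_assoc)
qed

text \<open>One term of the Leibniz rule, for a factor \<open>x\<close> of the left monomial. As
  \<open>\<delta> x\<close> already stands in front, additivity of inversions settles the
  sign.\<close>

lemma der_term_left:
  assumes "\<not> clsh {#x#} n" "\<not> clsh n m" "\<not> clsh {#x#} m"
  shows "pscale ((-1) ^ inv (add_mset x n) m) (\<tau> x (n + m)) = \<tau> x n \<cdot> mon m"
proof -
  have "inv ({#x#} + n) m = inv {#x#} m + inv n m"
    by (rule inversions_add_left[OF assms(1)])
  moreover have "inv {#x#} (n + m) = inv {#x#} n + inv {#x#} m"
    by (rule inversions_add_right[OF assms(2)])
  ultimately have "(-1 :: 'k) ^ inv (add_mset x n) m * (-1) ^ inv {#x#} (n + m)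
      = (-1) ^ inv {#x#} n * (-1) ^ inv n m"
    by (auto intro!: neg_one_power_cong simp flip: power_add)
  then show ?thesis using assms(2)
    by (simp add: der_term_def lam_mul_assoc mono_mul_pscale del: pscale_simps(7))
qed

text \<open>One term of the Leibniz rule, for a factor \<open>x\<close> of the right monomial. The
  degree of \<open>\<delta> x\<close> is one less than that of \<open>x\<close>, so moving it past
  \<open>m\<close> changes the sign by \<open>(-1) ^ ndeg m\<close> compared with moving
  \<open>x\<close>.\<close>

lemma der_term_right:
  assumes "\<not> clsh {#x#} n" "\<not> clsh n m" "\<not> clsh {#x#} m" "m \<in> M" "x \<in> X"
  shows "pscale ((-1) ^ inv m (add_mset x n)) (\<tau> x (m + n))
     = pscale ((-1) ^ ndeg m) (mon m \<cdot> \<tau> x n)"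
proof -
  have cl: "\<not> clsh m n" "\<not> clsh m {#x#}" using assms(2,3) by (auto simp: clash_sym[of deg m])
  have "inv m ({#x#} + n) = inv m {#x#} + inv m n"
    by (rule inversions_add_right[OF assms(1)])
  moreover have "inv {#x#} (m + n) = inv {#x#} m + inv {#x#} n"
    by (rule inversions_add_right[OF cl(1)])
  moreover have "even (inv m {#x#} + inv {#x#} m) \<longleftrightarrow> even (ndeg m * deg x)"
    using inversions_swap_parity[OF lin_ord assms(4) _ cl(2)] assms(5) by simp
  moreover have "even (ndeg m + ndeg m * (deg x - 1)) \<longleftrightarrow> even (ndeg m * deg x)"
    using deg_pos[OF assms(5)] by auto
  ultimately have "(-1 :: 'k) ^ inv m (add_mset x n) * (-1) ^ inv {#x#} (m + n)
      = (-1) ^ ndeg m * (-1) ^ inv {#x#} n * (-1) ^ (ndeg m * (deg x - 1)) * (-1) ^ inv m n"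
    by (auto intro!: neg_one_power_cong simp flip: power_add)
  then show ?thesis using cl(1)
    by (simp add: der_term_def mon_commute_gen_bdry[OF assms(4,5)] mono_mul_pscale mult.assoc
        del: pscale_simps(7))
qed

lemma der_term_clash_zero:
  assumes "clsh n m" shows "\<tau> x n \<cdot> mon m = 0"
  using assms by (simp add: der_term_def lam_mul_assoc mono_mul_alt)

lemma der_term_clash_zero':
  assumes "clsh m n" "m \<in> M" "x \<in> X" shows "mon m \<cdot> \<tau> x n = 0"
  using assms by (simp add: der_term_def mon_commute_gen_bdry mono_mul_alt)

text \<open>
  If the odd generator \<open>z\<close> divides both \<open>m\<close> and \<open>m'\<close>, then \<open>m \<cdot> m' = 0\<close>, and the two terms of
  \<open>(\<partial>m) \<cdot> m' \<plusminus> m \<cdot> \<partial>m'\<close> in which \<open>z\<close> is differentiated cancel.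
\<close>

lemma der_term_clash_cancel:
  assumes "add_mset z n \<in> M" "add_mset z n' \<in> M" "odd (deg z)"
  shows "\<tau> z n \<cdot> mon (add_mset z n')
    + pscale ((-1) ^ ndeg (add_mset z n)) (mon (add_mset z n) \<cdot> \<tau> z n') = 0"
proof (cases "clsh n n'")
  case True
  then show ?thesis
    using assms by (simp add: der_term_clash_zero der_term_clash_zero' monomials_add_mset)
next
  case False
  have z: "z \<in> X" "n \<in> M" "\<not> clsh {#z#} n" "z \<notin># n'" "z \<notin># n" "\<not> clsh n {#z#}" "\<not> clsh {#z#} n'"
    using assms by (auto simp: monomials_add_mset clash_sym[of deg n])
  have "inv n ({#z#} + n') = inv n {#z#} + inv n n'"
    by (rule inversions_add_right[OF z(7)])
  moreover have "inv ({#z#} + n) n' = inv {#z#} n' + inv n n'"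
    by (rule inversions_add_left[OF z(3)])
  moreover have "even (inv n {#z#} + inv {#z#} n) \<longleftrightarrow> even (ndeg n * deg z)"
    using inversions_swap_parity[OF lin_ord z(2) _ z(6)] z(1) by simp
  \<comment> \<open>Modulo 2 the left exponent is \<open>ndeg n + inv n n'\<close>, as
    \<open>deg z\<close> is odd. On the right the two copies of \<open>inv {#z#} n'\<close> cancel,
    and the odd \<open>deg z\<close> is compensated by the minus sign.\<close>
  ultimately have "(-1 :: 'k) ^ inv {#z#} n * (-1) ^ inv n (add_mset z n')
     = - ((-1) ^ ndeg (add_mset z n) * (-1) ^ inv {#z#} n' * (-1) ^ inv (add_mset z n) n')"
    using assms(3) by (auto simp: minus_one_power_iff simp flip: power_add power_Suc)
  moreover have "even (deg z - Suc 0)" using assms(3) by simp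
  ultimately show ?thesis using False z assms(3)
    by (simp add: der_term_def mon_commute_gen_bdry[OF assms(1) z(1)] mono_mul_pscale mult.assoc
        lam_mul_assoc del: pscale_simps(7) flip: pscale_add_left)
qed

lemma count_odd: "\<lbrakk>m \<in> M; x \<in># m; odd (deg x)\<rbrakk> \<Longrightarrow> count m x = 1"
  by (auto simp: monomials_def)

text \<open>Without a clash the multiplicities in \<open>m + m'\<close> add up, so the sum splits
  according to the monomial that supplies the differentiated factor. With a clash the product is
  zero and the right-hand side has to cancel.\<close>

lemma leibniz_mono:
  assumes m: "m \<in> M" "m' \<in> M"
  shows "dd (mono_mul deg r m m') = dm m \<cdot> mon m' + pscale ((-1) ^ ndeg m) (mon m \<cdot> dm m')"
proof (cases "clsh m m'")
  case False
  let ?s = "(-1 :: 'k) ^ inv m m'"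
  let ?t = "\<lambda>x. \<tau> x (m + m' - {#x#})"
  have L: "pscale ?s (?t x) = \<tau> x (m - {#x#}) \<cdot> mon m'" if x: "x \<in># m" for x
  proof -
    obtain n where n: "m = add_mset x n" using multi_member_split[OF x] by blast
    show ?thesis
      using der_term_left[of x n m'] m False by (simp add: n monomials_add_mset)
  qed
  have R: "pscale ?s (?t x) = pscale ((-1) ^ ndeg m) (mon m \<cdot> \<tau> x (m' - {#x#}))"
    if x: "x \<in># m'" for x
  proof -
    obtain n where n: "m' = add_mset x n" using multi_member_split[OF x] by blast
    show ?thesis
      using der_term_right[of x n m] m False
      by (simp add: n monomials_add_mset clash_sym[of deg n])
  qed
  have "pscale ?s (dm (m + m'))
      = (\<Sum>x\<in>set_mset m \<union> set_mset m'. pscale (of_nat (count m x)) (pscale ?s (?t x)))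
      + (\<Sum>x\<in>set_mset m \<union> set_mset m'. pscale (of_nat (count m' x)) (pscale ?s (?t x)))"
    by (simp add: der_mono_def pscale_sum pscale_add_left pscale_add_right mult.commute
        flip: sum.distrib)
  also have "(\<Sum>x\<in>set_mset m \<union> set_mset m'. pscale (of_nat (count m x)) (pscale ?s (?t x)))
      = (\<Sum>x\<in>set_mset m. pscale (of_nat (count m x)) (pscale ?s (?t x)))"
    by (rule sum.mono_neutral_right) (auto simp: not_in_iff)
  also have "\<dots> = dm m \<cdot> mon m'"
    by (simp add: der_mono_def lam_mul_sum L del: pscale_simps(5))
  also have "(\<Sum>x\<in>set_mset m \<union> set_mset m'. pscale (of_nat (count m' x)) (pscale ?s (?t x)))
      = (\<Sum>x\<in>set_mset m'. pscale (of_nat (count m' x)) (pscale ?s (?t x)))"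
    by (rule sum.mono_neutral_right) (auto simp: not_in_iff)
  also have "\<dots> = pscale ((-1) ^ ndeg m) (mon m \<cdot> dm m')"
    by (simp add: der_mono_def lam_mul_sum R pscale_sum mult.commute)
  finally show ?thesis using False by (simp add: mono_mul_alt)
next
  case True
  then obtain z where z: "z \<in># m" "z \<in># m'" "odd (deg z)"
    by (auto simp: clash_def odds_def)
  obtain n n' where n: "m = add_mset z n" "m' = add_mset z n'"
    using z multi_member_split by metis
  \<comment> \<open>If a generator other than \<open>z\<close> is differentiated, then
    \<open>z\<close> still divides both sides and the product vanishes; only the two terms for
    \<open>z\<close> survive.\<close>
  have L: "\<tau> x (m - {#x#}) \<cdot> mon m' = 0" if "x \<in># m" "x \<noteq> z" for x
    by (rule der_term_clash_zero)
      (use z that in \<open>auto simp: clash_def odds_def in_diff_count\<close>)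
  have R: "mon m \<cdot> \<tau> x (m' - {#x#}) = 0" if "x \<in># m'" "x \<noteq> z" for x
    by (rule der_term_clash_zero')
      (use z m that monomials_subset[OF m(2)] in \<open>auto simp: clash_def odds_def in_diff_count\<close>)
  have "dm m \<cdot> mon m' = (\<Sum>x\<in>set_mset m. pscale (of_nat (count m x)) (\<tau> x (m - {#x#}) \<cdot> mon m'))"
    by (simp add: der_mono_def lam_mul_sum)
  also have "\<dots> = (\<Sum>x\<in>{z}. pscale (of_nat (count m x)) (\<tau> x (m - {#x#}) \<cdot> mon m'))"
    by (rule sum.mono_neutral_right) (use z L in auto)
  also have "\<dots> = \<tau> z n \<cdot> mon m'"
    using count_odd[OF m(1) z(1,3)] n by simp
  finally have 1: "dm m \<cdot> mon m' = \<tau> z n \<cdot> mon m'" .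
  have "mon m \<cdot> dm m' = (\<Sum>x\<in>set_mset m'. pscale (of_nat (count m' x)) (mon m \<cdot> \<tau> x (m' - {#x#})))"
    by (simp add: der_mono_def lam_mul_sum)
  also have "\<dots> = (\<Sum>x\<in>{z}. pscale (of_nat (count m' x)) (mon m \<cdot> \<tau> x (m' - {#x#})))"
    by (rule sum.mono_neutral_right) (use z R in auto)
  also have "\<dots> = mon m \<cdot> \<tau> z n'"
    using count_odd[OF m(2) z(2,3)] n by simp
  finally show ?thesis
    using 1 True der_term_clash_cancel[of z n n'] m z(3) by (simp add: mono_mul_alt n)
qed

lemma leibniz:
  assumes "f \<in> homog X deg p" "keys g \<subseteq> M"
  shows "dd (f \<cdot> g) = dd f \<cdot> g + pscale ((-1) ^ p) (f \<cdot> dd g)"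
proof (rule linear_map_eqI[where f = f])
  fix m assume m: "m \<in> keys f"
  show "dd (mon m \<cdot> g) = dd (mon m) \<cdot> g + pscale ((-1) ^ p) (mon m \<cdot> dd g)"
    by (rule linear_map_eqI[where f = g])
      (use homog_lookupD[OF assms(1) m] assms(2) in \<open>auto intro!: linear_intros simp: leibniz_mono\<close>)
qed (intro linear_intros)+

lemmas der_mono_homog = der_mono_homog_aux[OF _ gen_bdry deg_pos]

lemma der_homog: "f \<in> homog X deg p \<Longrightarrow> dd f \<in> homog X deg (p - 1)"
  by (rule homog_linear_map[OF linear_der']) (use der_mono_homog homog_lookupD in fastforce)

lemma ndeg_0_iff: "m \<in> M \<Longrightarrow> ndeg m = 0 \<longleftrightarrow> m = {#}"
  using deg_pos by (cases m) (auto simp: monomials_add_mset)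

lemma der_degree_0:
  assumes "f \<in> homog X deg 0" shows "dd f = 0"
proof (rule linear_map_eqI[of dd "\<lambda>f. 0" f])
  fix m assume "m \<in> keys f"
  then have "m = {#}" using homog_lookupD[OF assms] ndeg_0_iff by blast
  then show "dd (mon m) = 0" by simp
qed (intro linear_intros)+

lemma mon_add_mset:
  assumes "add_mset x n \<in> M"
  shows "mon (add_mset x n) = pscale ((-1) ^ inv {#x#} n) (mon {#x#} \<cdot> mon n)"
proof -
  have "\<not> clsh {#x#} n" using assms by (simp add: monomials_add_mset)
  then show ?thesis by (auto simp: mono_mul_alt)
qed

text \<open>Peeling off \<open>x\<close> leaves two mixed terms
  \<open>\<delta> x \<cdot> dm n\<close> with opposite signs. The bound \<open>N\<close> makes the
  lemma usable while the square is known to vanish only on generators of smaller degree.\<close>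

lemma der_der_mono:
  assumes "\<And>x. \<lbrakk>x \<in> X; deg x \<le> N\<rbrakk> \<Longrightarrow> dd (\<delta> x) = 0"
  shows "\<lbrakk>m \<in> M; ndeg m \<le> N\<rbrakk> \<Longrightarrow> dd (dm m) = 0"
proof (induction m)
  case (add x n)
  let ?s = "(-1 :: 'k) ^ inv {#x#} n"
  have x: "x \<in> X" "n \<in> M" and IH: "dd (dm n) = 0"
    using add by (auto simp: monomials_add_mset)
  have dx: "dd (\<delta> x) = 0" using assms x add.prems by auto
  have n: "keys (dm n) \<subseteq> M" using der_mono_homog[OF x(2)] by (auto simp: homog_def)
  have "dm (add_mset x n) = dd (mon (add_mset x n))"
    by (simp only: der_single pscale_simps)
  also have "\<dots> = pscale ?s (dd (mon {#x#} \<cdot> mon n))"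
    unfolding mon_add_mset[OF add.prems(1)] by (simp only: der_pscale)
  also have "dd (mon {#x#} \<cdot> mon n)
      = \<delta> x \<cdot> mon n + pscale ((-1) ^ deg x) (mon {#x#} \<cdot> dm n)"
    using leibniz[of "mon {#x#}" "deg x" "mon n"] x
    by (simp add: single_homog del: lam_mul_single)
  finally have "dd (dm (add_mset x n))
      = pscale ?s (dd (\<delta> x \<cdot> mon n) + pscale ((-1) ^ deg x) (dd (mon {#x#} \<cdot> dm n)))"
    by (simp add: der_add pscale_add_right)
  also have "dd (\<delta> x \<cdot> mon n) = pscale ((-1) ^ (deg x - 1)) (\<delta> x \<cdot> dm n)"
    using leibniz[OF gen_bdry[OF x(1)], of "mon n"] x(2) dx by simp
  also have "dd (mon {#x#} \<cdot> dm n) = \<delta> x \<cdot> dm n"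
    using leibniz[of "mon {#x#}" "deg x" "dm n"] x n IH by (simp add: single_homog)
  also have "(-1 :: 'k) ^ deg x = - ((-1) ^ (deg x - 1))"
    using deg_pos[OF x(1)] by (metis Suc_pred' mult_minus1 power_Suc)
  finally show ?case by (simp add: pscale_minus_left del: lam_mul_single)
qed simp

text \<open>Each element is the sum of its monomial terms, and these are homogeneous; so membership
  in the carrier becomes a condition on supports.\<close>

lemma span_homog:
  "module.span pscale (\<Union>n. homog X deg n) = {f :: 'x multiset \<Rightarrow>\<^sub>0 'k. keys f \<subseteq> M}"
proof (rule module.span_unique[OF module_pscale])
  show "(\<Union>n. homog X deg n) \<subseteq> {f. keys f \<subseteq> M}"
    by (auto simp: homog_def)
  show "module.subspace pscale {f :: 'x multiset \<Rightarrow>\<^sub>0 'k. keys f \<subseteq> M}"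
    unfolding module.subspace_def[OF module_pscale]
    by (auto dest!: keys_add[THEN subsetD] keys_pscale[THEN subsetD])
next
  fix T :: "('x multiset \<Rightarrow>\<^sub>0 'k) set" assume T: "(\<Union>n. homog X deg n) \<subseteq> T" "module.subspace pscale T"
  show "{f :: 'x multiset \<Rightarrow>\<^sub>0 'k. keys f \<subseteq> M} \<subseteq> T"
  proof
    fix f :: "'x multiset \<Rightarrow>\<^sub>0 'k" assume "f \<in> {f. keys f \<subseteq> M}"
    then have "single m 1 \<in> T" if "m \<in> keys f" for m
      using that T(1) single_homog[of m X deg "ndeg m" 1] by blast
    then have "lin_ext (\<lambda>m. single m 1) f \<in> T"
      unfolding lin_ext_def
      by (intro module.subspace_sum[OF module_pscale T(2)] module.subspace_scale[OF module_pscale T(2)])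
    then show "f \<in> T" by (simp add: lin_ext_single_one)
  qed
qed

lemma free_alg_simps [simp]:
  "hom_part (free_alg X deg r d) n = homog X deg n" "scl (free_alg X deg r d) = pscale"
  "mul (free_alg X deg r d) = lam_mul deg r" "unity (free_alg X deg r d) = single {#} 1"
  "bdry (free_alg X deg r d) = d"
  by (simp_all add: free_alg_def homog_def)

lemma carrier_free_alg [simp]:
  "carrier_of (free_alg X deg r d) = {f :: 'x multiset \<Rightarrow>\<^sub>0 'k. keys f \<subseteq> M}"
  by (simp add: carrier_of_def span_homog)

lemma chain_algebra_free_alg:
  assumes "\<And>x. x \<in> X \<Longrightarrow> dd (\<delta> x) = 0"
  shows "chain_algebra (free_alg X deg r dd)"
proof (unfold_locales, unfold free_alg_simps carrier_free_alg)
  show "module.subspace pscale (homog X deg n :: ('x multiset \<Rightarrow>\<^sub>0 'k) set)" for n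
    by (simp add: module.subspace_def[OF module_pscale] homog_add homog_pscale)
next
  fix n j :: nat and f :: "nat \<Rightarrow> ('x multiset \<Rightarrow>\<^sub>0 'k)"
  assume f: "\<And>i. i \<le> n \<Longrightarrow> f i \<in> homog X deg i" "(\<Sum>i\<le>n. f i) = 0" "j \<le> n"
  show "f j = 0"
  proof (rule ccontr)
    assume "f j \<noteq> 0"
    then obtain m where m: "m \<in> keys (f j)" by (metis all_not_in_conv keys_eq_empty)
    then have "ndeg m = j" using f(1,3) homog_lookupD by blast
    then have "lookup (f i) m = 0" if "i \<le> n" "i \<noteq> j" for i
      using that f(1) homog_lookupD in_keys_iff by metis
    then have "lookup (\<Sum>i\<le>n. f i) m = (\<Sum>i\<in>{j}. lookup (f i) m)"
      unfolding lookup_sum using f(3) by (intro sum.mono_neutral_right) auto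
    then show False using f(2) m by (simp add: in_keys_iff)
  qed
next
  fix a b :: "'x multiset \<Rightarrow>\<^sub>0 'k" and m n
  assume "a \<in> homog X deg m" "b \<in> homog X deg n"
  then show "dd (a \<cdot> b) = dd a \<cdot> b + pscale ((-1) ^ m) (a \<cdot> dd b)"
    by (intro leibniz) (auto simp: homog_def)
next
  fix a :: "'x multiset \<Rightarrow>\<^sub>0 'k" assume a: "a \<in> {f. keys f \<subseteq> M}"
  show "dd (dd a) = 0"
    by (rule linear_map_eqI[of "\<lambda>f. dd (dd f)" "\<lambda>f. 0" a])
      (use a assms in \<open>auto intro!: linear_intros der_der_mono[OF _ _ order_refl]\<close>)
next
  fix a b :: "'x multiset \<Rightarrow>\<^sub>0 'k" and m n
  assume ab: "a \<in> homog X deg m" "b \<in> homog X deg n"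
  show "a \<cdot> b \<in> homog X deg (m + n)" by (rule homog_lam_mul[OF ab])
  show "b \<cdot> a = pscale ((-1) ^ (m * n)) (a \<cdot> b)" by (rule lam_mul_commute[OF lin_ord ab])
next
  fix a :: "'x multiset \<Rightarrow>\<^sub>0 'k" and n
  assume a: "a \<in> homog X deg n"
  show "odd n \<Longrightarrow> a \<cdot> a = 0" by (rule lam_mul_odd_square[OF lin_ord a])
next
  show "dd a \<in> homog X deg n" if "a \<in> homog X deg (Suc n)" for a n
    using der_homog[OF that] by simp
  show "dd a = 0" if "a \<in> homog X deg 0" for a
    by (rule der_degree_0[OF that])
qed (auto simp: module_pscale pscale_add_left pscale_add_right lam_mul_add lam_mul_assoc der_add single_homog)

end

section \<open>A model of the ground ring with an explicit contraction\<close>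

text \<open>The constant monomial goes to 0 and not to the generator \<open>s {#}\<close>: only the
  augmentation ideal is to be contracted.\<close>

definition cone :: "('x multiset \<Rightarrow> 'x) \<Rightarrow> ('x multiset \<Rightarrow>\<^sub>0 'k) \<Rightarrow> ('x multiset \<Rightarrow>\<^sub>0 'k::comm_ring_1)" where
  "cone s = lin_ext (\<lambda>m. if m = {#} then 0 else single {#s m#} 1)"

lemma cone_single [simp]: "cone s (single m c) = (if m = {#} then 0 else single {#s m#} c)"
  by (simp add: cone_def)

lemma linear_cone [linear_intros]: "linear_map F \<Longrightarrow> linear_map (\<lambda>f. cone s (F f))"
  unfolding cone_def by (rule linear_intros)

locale cone_generators =
  fixes X :: "'x set" and deg :: "'x \<Rightarrow> nat" and r :: "'x rel" and s :: "'x multiset \<Rightarrow> 'x"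
  assumes lin_ord: "linear_order_on X r"
    and inj_s: "inj_on s (monomials X deg)"
    and image_s: "s ` monomials X deg = X"
    and deg_s: "m \<in> monomials X deg \<Longrightarrow> deg (s m) = Suc (mdeg deg m)"
begin

text \<open>The equation \<partial>h + h\<partial> = 1 solved for the boundary of the generator
  \<open>s m\<close>, where h is \<open>cone s\<close>. The recursion goes through the factors of
  \<open>m\<close>, whose degrees are smaller than that of \<open>s m\<close>. The generator
  \<open>s {#}\<close> is made a cycle.\<close>

function cone_bdry :: "'x \<Rightarrow> ('x multiset \<Rightarrow>\<^sub>0 'k::comm_ring_1)" where
  "cone_bdry x =
     (if x \<in> X \<and> inv_into (monomials X deg) s x \<noteq> {#}
      then single (inv_into (monomials X deg) s x) 1
        - cone s (der_mono deg r cone_bdry (inv_into (monomials X deg) s x))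
      else 0)"
  by auto
termination
proof (relation "measure deg")
  fix x y assume x: "x \<in> X \<and> inv_into (monomials X deg) s x \<noteq> {#}"
    and y: "y \<in># inv_into (monomials X deg) s x"
  let ?m = "inv_into (monomials X deg) s x"
  have "s ?m = x" "?m \<in> monomials X deg"
    using x image_s f_inv_into_f[of x s] inv_into_into[of x s] by auto
  moreover have "deg y \<le> mdeg deg ?m"
    using y multi_member_split[OF y] by auto
  ultimately show "(y, x) \<in> measure deg" using deg_s[of ?m] by simp
qed auto

lemma cone_bdry_s:
  "m \<in> monomials X deg \<Longrightarrow> cone_bdry (s m)
     = (if m = {#} then 0 else single m 1 - cone s (der_mono deg r cone_bdry m))"
  using image_s by (subst cone_bdry.simps) (auto simp: inv_into_f_f[OF inj_s])

end

text \<open>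
  The value of \<open>\<delta> (s m)\<close> is the one for which \<open>cone s\<close> is a contraction of the augmentation ideal.
\<close>

locale cone_algebra = cone_generators X deg r s
  for X :: "'x set" and deg :: "'x \<Rightarrow> nat" and r :: "'x rel" and s :: "'x multiset \<Rightarrow> 'x" +
  fixes \<delta> :: "'x \<Rightarrow> ('x multiset \<Rightarrow>\<^sub>0 'k::comm_ring_1)"
  assumes bdry_s: "m \<in> monomials X deg \<Longrightarrow>
    \<delta> (s m) = (if m = {#} then 0 else single m 1 - cone s (der_mono deg r \<delta> m))"
begin

lemma obtain_monomial:
  assumes "x \<in> X" obtains m where "m \<in> monomials X deg" "x = s m"
  using assms image_s by auto

lemma s_in [simp]: "m \<in> monomials X deg \<Longrightarrow> s m \<in> X"
  using image_s by auto

lemma cone_homog: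
  assumes "f \<in> homog X deg n" shows "cone s f \<in> homog X deg (Suc n)"
  by (rule homog_linear_map[OF linear_cone[OF linear_ident]])
    (use homog_lookupD[OF assms] deg_s in \<open>auto intro!: single_homog\<close>)

lemma gens_pos: "x \<in> X \<Longrightarrow> deg x > 0"
  using deg_s by (auto elim: obtain_monomial)

lemma bdry_homog: "x \<in> X \<Longrightarrow> \<delta> x \<in> homog X deg (deg x - 1)"
proof (induction "deg x" arbitrary: x rule: less_induct)
  case less
  obtain m where m: "m \<in> monomials X deg" "x = s m"
    using less.prems by (rule obtain_monomial)
  show ?case
  proof (cases "m = {#}")
    case False
    have "deg y < deg x" if "y \<in># m" for y
      using multi_member_split[OF that] m deg_s by auto
    then have "der_mono deg r \<delta> m \<in> homog X deg (mdeg deg m - 1)"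
      using less.hyps gens_pos by (intro der_mono_homog_aux m) auto
    moreover have "mdeg deg m > 0"
      using False m gens_pos by (cases m) (auto simp: monomials_add_mset)
    ultimately have "cone s (der_mono deg r \<delta> m) \<in> homog X deg (mdeg deg m)"
      using cone_homog by fastforce
    then show ?thesis
      using m deg_s False by (auto simp: bdry_s intro!: homog_diff single_homog)
  qed (simp add: m bdry_s)
qed

sublocale free_gca X deg r \<delta>
  by unfold_locales (fact lin_ord gens_pos bdry_homog)+

section \<open>Generators of low degree and the contracting homotopy\<close>

abbreviation gy :: 'x where "gy \<equiv> s {#}"
abbreviation gx :: 'x where "gx \<equiv> s {#gy#}"

lemma generators [simp]:
  "gy \<in> X" "gx \<in> X" "deg gy = 1" "deg gx = 2" "\<delta> gy = 0" "\<delta> gx = mon {#gy#}" "gx \<noteq> gy" "gy \<noteq> gx"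
proof -
  show y: "gy \<in> X" "deg gy = 1" "\<delta> gy = 0" using deg_s bdry_s by auto
  then have m: "{#gy#} \<in> M" by simp
  show "gx \<in> X" "deg gx = 2" using deg_s[OF m] y m by auto
  then show "gx \<noteq> gy" "gy \<noteq> gx" using y by auto
  show "\<delta> gx = mon {#gy#}"
    using bdry_s[OF m] y linear_map_0[OF linear_cone[OF linear_ident], of s] by simp
qed

lemma ndeg_1_iff: "m \<in> M \<Longrightarrow> ndeg m = 1 \<longleftrightarrow> m = {#gy#}"
proof
  assume m: "m \<in> M" "ndeg m = 1"
  then obtain x n where x: "m = add_mset x n" by (cases m) auto
  then have *: "x \<in> X" "n \<in> M" using m by (auto simp: monomials_add_mset)
  then have "deg x = 1" "ndeg n = 0" using m(2) x deg_pos[of x] by auto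
  moreover obtain k where "k \<in> M" "x = s k" using obtain_monomial *(1) by blast
  ultimately show "m = {#gy#}" using x * deg_s ndeg_0_iff by auto
qed simp

text \<open>A monomial of degree 2 is a single generator \<open>s m\<close> with \<open>m\<close> of
  degree 1, or a product of two generators of degree 1. The latter would be the square of the odd
  \<open>gy\<close>, which is not a monomial.\<close>

lemma ndeg_2_iff: "m \<in> M \<Longrightarrow> ndeg m = 2 \<longleftrightarrow> m = {#gx#}"
proof
  assume m: "m \<in> M" "ndeg m = 2"
  then obtain x n where x: "m = add_mset x n" by (cases m) auto
  then have *: "x \<in> X" "n \<in> M" "\<not> (odd (deg x) \<and> x \<in># n)" using m by (auto simp: monomials_add_mset)
  have "deg x \<noteq> 1"
  proof
    assume d: "deg x = 1"
    then have "{#x#} = {#gy#}" using ndeg_1_iff[of "{#x#}"] * by simp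
    moreover have "n = {#gy#}" using ndeg_1_iff[of n] * d x m by simp
    ultimately show False using * by simp
  qed
  then have "deg x = 2" "ndeg n = 0" using m(2) x deg_pos[of x] * by auto
  moreover obtain k where "k \<in> M" "x = s k" using obtain_monomial *(1) by blast
  ultimately show "m = {#gx#}" using x * deg_s ndeg_0_iff ndeg_1_iff by auto
qed simp

text \<open>A constant term can only come from degree at most 1, where the boundary is zero. Thus
  boundaries stay in the augmentation ideal, where the contraction works.\<close>

lemma der_mono_no_const:
  assumes m: "m \<in> M" shows "{#} \<notin> keys (dm m)"
proof
  assume "{#} \<in> keys (dm m)"
  then have "ndeg m \<le> 1" using homog_lookupD[OF der_mono_homog[OF m]] by fastforce
  then have "m = {#} \<or> m = {#gy#}" using m ndeg_0_iff ndeg_1_iff by force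
  then have "dm m = 0" by auto
  with \<open>{#} \<in> keys (dm m)\<close> show False by simp
qed

lemma der_no_const:
  assumes "keys f \<subseteq> M" shows "{#} \<notin> keys (dd f)"
  using keys_linear_map[OF linear_der', of f deg r \<delta> "- {{#}}"] der_mono_no_const assms by auto

lemma der_cone:
  assumes "keys f \<subseteq> M" "{#} \<notin> keys f"
  shows "dd (cone s f) = f - cone s (dd f)"
  by (rule linear_map_eqI[of "\<lambda>f. dd (cone s f)" "\<lambda>f. f - cone s (dd f)"])
    (use assms in \<open>auto intro!: linear_intros simp: bdry_s\<close>)

text \<open>Applying \<partial> to \<partial>(s m) = m - h\<partial>m and using \<partial>h = 1 -
  h\<partial> on \<partial>m leaves h\<partial>\<partial>m, which vanishes by induction on the
  degree.\<close>

lemma bdry_bdry: "x \<in> X \<Longrightarrow> dd (\<delta> x) = 0"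
proof (induction "deg x" arbitrary: x rule: less_induct)
  case less
  obtain m where m: "m \<in> M" "x = s m"
    using less.prems by (rule obtain_monomial)
  have "dd (dm m) = 0"
    by (rule der_der_mono[OF _ m(1) order_refl]) (use less deg_s m in auto)
  moreover have "keys (dm m) \<subseteq> M" using der_mono_homog[OF m(1)] by (auto simp: homog_def)
  ultimately have "dd (cone s (dm m)) = dm m"
    using der_cone[of "dm m"] der_mono_no_const[OF m(1)]
      linear_map_0[OF linear_cone[OF linear_ident], of s] by simp
  then show ?case using m by (simp add: bdry_s der_diff)
qed

lemma der_der: "keys f \<subseteq> M \<Longrightarrow> dd (dd f) = 0"
  using chain_algebra.bdry_bdry[OF chain_algebra_free_alg[OF bdry_bdry], of f] by simp

lemma cycle_is_boundary:
  assumes "f \<in> homog X deg n" "n > 0" "dd f = 0"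
  shows "dd (cone s f) = f"
proof -
  have "{#} \<notin> keys f" using homog_lookupD[OF assms(1)] assms(2) by fastforce
  moreover have "keys f \<subseteq> M" using assms(1) by (auto simp: homog_def)
  ultimately show ?thesis
    using der_cone[of f] assms(3) linear_map_0[OF linear_cone[OF linear_ident], of s] by simp
qed

lemma der_degree_1:
  assumes "f \<in> homog X deg 1" shows "dd f = 0"
proof (rule linear_map_eqI[of dd "\<lambda>f. 0" f])
  fix m assume "m \<in> keys f"
  then have "m = {#gy#}" using homog_lookupD[OF assms] ndeg_1_iff by blast
  then show "dd (mon m) = 0" by simp
qed (intro linear_intros)+

end

section \<open>Comparison of homology with the ground ring\<close>

lemma subquot_zero: "subquot Z {0} = (\<lambda>z. {z}) ` Z"
  by (auto simp: subquot_def quotient_def)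

lemma subquot_self:
  assumes "Z \<noteq> {}" "\<And>x y. \<lbrakk>x \<in> Z; y \<in> Z\<rbrakk> \<Longrightarrow> x - y \<in> Z"
  shows "subquot Z Z = {Z}"
proof -
  have "{(x, y). x \<in> Z \<and> y \<in> Z \<and> x - y \<in> Z} `` {z} = Z" if "z \<in> Z" for z
    using assms that by auto
  then show ?thesis using assms(1) by (auto simp: subquot_def quotient_def)
qed

lemma ground_simps [simp]:
  "hom_part ground n = (if n = 0 then UNIV else {0})" "scl ground = (*)" "mul ground = (*)"
  "unity ground = 1" "bdry ground = (\<lambda>_. 0)"
  by (simp_all add: ground_def)

lemma module_mult: "module ((*) :: 'k::comm_ring_1 \<Rightarrow> _)"
  by standard (simp_all add: algebra_simps)

lemma carrier_ground [simp]: "carrier_of (ground :: ('k::comm_ring_1, 'k) chain_alg) = UNIV"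
proof -
  have "(\<Union>n. hom_part (ground :: ('k, 'k) chain_alg) n) = UNIV" by auto
  then show ?thesis
    using module.span_superset[OF module_mult, of UNIV] by (auto simp: carrier_of_def)
qed

lemma chain_algebra_ground: "chain_algebra (ground :: ('k::comm_ring_1, 'k) chain_alg)"
proof (unfold_locales, unfold ground_simps carrier_ground)
  fix n :: nat
  show "module.subspace (*) (if n = 0 then UNIV else {0 :: 'k})"
    by (simp add: module.subspace_def[OF module_mult])
next
  fix n j :: nat and f :: "nat \<Rightarrow> 'k"
  assume f: "\<And>i. i \<le> n \<Longrightarrow> f i \<in> (if i = 0 then UNIV else {0})" "(\<Sum>i\<le>n. f i) = 0" "j \<le> n"
  have "f i = 0" if "i \<le> n" "i \<noteq> 0" for i
    using f(1)[OF that(1)] that(2) by simp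
  then have "(\<Sum>i\<le>n. f i) = (\<Sum>i\<in>{0}. f i)"
    by (intro sum.mono_neutral_right) auto
  then show "f j = 0" using f(1)[OF f(3)] f(2) by (auto split: if_splits)
qed (auto simp: module_mult algebra_simps split: if_splits)

context cone_algebra
begin

lemma lookup_mult_const:
  fixes f g :: "'x multiset \<Rightarrow>\<^sub>0 'k"
  shows "lookup (f \<cdot> g) {#} = lookup f {#} * lookup g {#}"
proof -
  \<comment> \<open>The coefficient functional is replaced by the projection onto the constants, so
    that both sides become linear maps between free modules.\<close>
  let ?E = "\<lambda>f :: 'x multiset \<Rightarrow>\<^sub>0 'k. single ({#} :: 'x multiset) (lookup f {#})"
  have lin: "linear_map ?E"
    by (rule linear_mapI) (simp_all add: lookup_add single_add)
  have "?E (f \<cdot> g) = ?E f \<cdot> ?E g"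
  proof (rule linear_map_eqI[where f = f])
    fix m
    show "?E (mon m \<cdot> g) = ?E (mon m) \<cdot> ?E g"
      by (rule linear_map_eqI[where f = g])
        (auto intro!: linear_intros lin linear_compose[OF lin] linear_lam_mul_compose
          simp: mono_mul_alt lookup_single when_def)
  qed (intro linear_intros lin linear_compose[OF lin])+
  then have "lookup (?E (f \<cdot> g)) {#} = lookup (?E f \<cdot> ?E g) {#}" by simp
  then show ?thesis by (simp add: mono_mul_alt)
qed

text \<open>In degree 0 all elements are constants and there are no nonzero boundaries. In positive
  degree the contraction makes every cycle a boundary, so both homology groups consist of a single
  coset.\<close>

lemma homology_map_const:
  "bij_betw (homology_map ground (\<lambda>f. lookup f {#}) n) (homology (free_alg X deg r dd) n)
     (homology (ground :: ('k, 'k) chain_alg) n)"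
proof -
  let ?A = "free_alg X deg r dd" and ?G = "ground :: ('k, 'k) chain_alg"
  let ?H = "homology_map ?G (\<lambda>f. lookup f {#}) n"
  have G: "cycles ?G n = hom_part ?G n" "boundaries ?G n = {0}" for n
    by (auto simp: cycles_def boundaries_def)
  have HG: "homology ?G n = (\<lambda>z. {z}) ` hom_part ?G n"
    by (simp only: homology_def G subquot_zero)
  show ?thesis
  proof (cases "n = 0")
    case True
    have "cycles ?A n = homog X deg 0" using True der_degree_0 by (auto simp: cycles_def)
    moreover have "boundaries ?A n = {0}"
    proof -
      have "dd ` homog X deg 1 \<subseteq> {0}" using der_degree_1 by auto
      moreover have "dd 0 \<in> dd ` homog X deg 1" by (rule imageI) simp
      ultimately show ?thesis using True by (auto simp: boundaries_def)
    qed
    ultimately have HA: "homology ?A n = (\<lambda>z. {z}) ` homog X deg 0"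
      by (simp only: homology_def subquot_zero)
    have H: "?H {f} = {lookup f {#}}" for f
      using True by (auto simp: homology_map_def G)
    have "inj_on (\<lambda>f :: 'x multiset \<Rightarrow>\<^sub>0 'k. lookup f {#}) (homog X deg 0)"
    proof (rule inj_onI, rule poly_mapping_eqI)
      fix f g :: "'x multiset \<Rightarrow>\<^sub>0 'k" and m
      assume *: "f \<in> homog X deg 0" "g \<in> homog X deg 0" "lookup f {#} = lookup g {#}"
      show "lookup f m = lookup g m"
      proof (cases "m = {#}")
        case False
        then have "m \<notin> keys f" "m \<notin> keys g"
          using * homog_lookupD ndeg_0_iff by blast+
        then show ?thesis by (simp add: in_keys_iff)
      qed (use * in simp)
    qed
    then have "inj_on ?H (homology ?A n)"
      unfolding HA by (auto simp: inj_on_def H)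
    moreover have "?H ` homology ?A n = homology ?G n"
    proof -
      have "{t} \<in> ?H ` homology ?A n" for t :: 'k
      proof -
        have "single {#} t \<in> homog X deg 0" by (simp add: single_homog)
        moreover have "?H {single {#} t} = {t}" by (simp add: H)
        ultimately show ?thesis unfolding HA by (metis imageI)
      qed
      then show ?thesis unfolding HA HG using True by (auto simp: H[unfolded True])
    qed
    ultimately show ?thesis by (simp add: bij_betw_def)
  next
    case False
    let ?Z = "cycles ?A n"
    have "boundaries ?A n = ?Z"
    proof
      show "boundaries ?A n \<subseteq> ?Z"
        using der_homog[of _ "Suc n"] der_der by (auto simp: boundaries_def cycles_def homog_def)
      show "?Z \<subseteq> boundaries ?A n"
      proof
        fix f assume "f \<in> ?Z"
        then have f: "f \<in> homog X deg n" "dd f = 0" by (auto simp: cycles_def)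
        then have "dd (cone s f) = f" using cycle_is_boundary False by blast
        then show "f \<in> boundaries ?A n"
          using cone_homog[OF f(1)] by (auto simp: boundaries_def intro!: image_eqI[of _ _ "cone s f"])
      qed
    qed
    moreover have Z: "0 \<in> ?Z" by (simp add: cycles_def)
    have "subquot ?Z ?Z = {?Z}"
    proof (rule subquot_self)
      show "f - g \<in> ?Z" if "f \<in> ?Z" "g \<in> ?Z" for f g
        using that by (auto simp: cycles_def der_diff homog_diff)
    qed (use Z in blast)
    ultimately have "homology ?A n = {?Z}" by (simp only: homology_def)
    moreover have "?H ?Z = {0}"
    proof -
      have "\<exists>f\<in>?Z. lookup f {#} - 0 \<in> {0}" by (rule bexI[OF _ Z]) simp
      then show ?thesis using False by (auto simp: homology_map_def G)
    qed
    ultimately show ?thesis using False by (simp add: HG bij_betw_def)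
  qed
qed

lemma cone_is_model: "is_model X deg r dd ground (\<lambda>f. lookup f {#})"
proof -
  have "lookup f {#} = 0" if "f \<in> homog X deg n" "n \<noteq> 0" for f :: "'x multiset \<Rightarrow>\<^sub>0 'k" and n
    using homog_lookupD[OF that(1), of "{#}"] that(2) by (auto simp: in_keys_iff)
  then have "chain_alg_hom (free_alg X deg r dd) ground (\<lambda>f. lookup f {#})"
    using der_no_const
    by (auto simp: chain_alg_hom_def lookup_add lookup_mult_const in_keys_iff)
  then have "quasi_iso (free_alg X deg r dd) ground (\<lambda>f. lookup f {#})"
    by (simp add: quasi_iso_def homology_map_const)
  moreover have "(\<lambda>f. lookup f {#}) ` {f. keys f \<subseteq> M} = (UNIV :: 'k set)"
  proof -
    have "t \<in> (\<lambda>f. lookup f {#}) ` {f. keys f \<subseteq> M}" for t :: 'k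
      by (rule image_eqI[of _ _ "single {#} t"]) auto
    then show ?thesis by auto
  qed
  ultimately show ?thesis
    by (simp add: is_model_def lin_ord chain_algebra_ground chain_algebra_free_alg[OF bdry_bdry])
qed

end

subsection \<open>Existence of the generators\<close>

text \<open>A number codes the generator \<open>s m\<close>, where its decoded list holds the codes
  of the factors of \<open>m\<close>. The entries of a list are smaller than its code, so the degree
  is defined by recursion; the number 0 codes the generator of degree 1.\<close>

function code_deg :: "nat \<Rightarrow> nat" where
  "code_deg n = Suc (sum_list (map code_deg (list_decode n)))"
  by auto
termination
proof (relation "measure (\<lambda>n. n)")
  have "i \<in> set l \<Longrightarrow> i < list_encode l" for i l
  proof (induction l)
    case (Cons a l)
    then show ?case
      using le_prod_encode_1[of a "list_encode l"] le_prod_encode_2[of "list_encode l" a] by auto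
  qed simp
  then show "(i, n) \<in> measure (\<lambda>n. n)" if "i \<in> set (list_decode n)" for i n
    using that by (metis in_measure list_decode_inverse)
qed auto

text \<open>Closure makes \<open>s\<close> map the monomials over this set into the set, and
  minimality makes it map onto the set.\<close>

inductive_set gens :: "('x multiset \<Rightarrow> 'x) \<Rightarrow> ('x \<Rightarrow> nat) \<Rightarrow> 'x set" for s deg where
  "\<lbrakk>\<forall>x. x \<in># m \<longrightarrow> x \<in> gens s deg; \<forall>x \<in># m. odd (deg x) \<longrightarrow> count m x = 1\<rbrakk>
    \<Longrightarrow> s m \<in> gens s deg"

lemma cone_generators_exist:
  assumes "infinite (UNIV :: 'x set)"
  shows "\<exists>X deg r (s :: 'x multiset \<Rightarrow> 'x). cone_generators X deg r s"
proof -
  obtain f :: "nat \<Rightarrow> 'x" where f: "inj f"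
    using assms infinite_countable_subset by blast
  define g where "g = inv f"
  \<comment> \<open>Sorting makes the code of the list a function of the multiset. The map is
    injective on multisets over \<open>X\<close>, since \<open>g\<close> inverts \<open>f\<close>
    there.\<close>
  define s where "s m = f (list_encode (sorted_list_of_multiset (image_mset g m)))" for m
  define deg where "deg x = code_deg (g x)" for x
  define X where "X = gens s deg"
  have gf [simp]: "g (f n) = n" for n using f by (simp add: g_def)
  have "X \<subseteq> range f" unfolding X_def by (auto elim!: gens.cases simp: s_def)
  then have fg: "f (g x) = x" if "x \<in> X" for x using that by auto
  have inj: "m = m'" if "s m = s m'" "set_mset m \<subseteq> X" "set_mset m' \<subseteq> X" for m m'
  proof -
    have "sorted_list_of_multiset (image_mset g m) = sorted_list_of_multiset (image_mset g m')"
      using that(1) f by (simp add: s_def inj_eq list_encode_eq)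
    then have "image_mset g m = image_mset g m'" by (metis mset_sorted_list_of_multiset)
    then have "image_mset f (image_mset g m) = image_mset f (image_mset g m')" by simp
    moreover have "image_mset f (image_mset g k) = k" if "set_mset k \<subseteq> X" for k
    proof -
      have "image_mset (\<lambda>x. f (g x)) k = image_mset (\<lambda>x. x) k"
        by (rule image_mset_cong) (use that fg in auto)
      then show ?thesis by (simp add: multiset.map_comp comp_def)
    qed
    ultimately show ?thesis using that by simp
  qed
  obtain r where "well_order_on X r" using well_order_on by blast
  then have "linear_order_on X r" by (simp add: well_order_on_def)
  moreover have "inj_on s (monomials X deg)"
    using inj by (auto simp: inj_on_def monomials_def)
  moreover have "s ` monomials X deg = X"
  proof
    show "s ` monomials X deg \<subseteq> X"
      unfolding X_def monomials_def by (auto intro!: gens.intros)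
    show "X \<subseteq> s ` monomials X deg"
      unfolding X_def monomials_def by (auto elim!: gens.cases)
  qed
  moreover have "deg (s m) = Suc (mdeg deg m)" for m
  proof -
    have "deg (s m) = Suc (sum_list (map code_deg (sorted_list_of_multiset (image_mset g m))))"
      by (simp add: deg_def s_def)
    also have "sum_list (map code_deg (sorted_list_of_multiset (image_mset g m)))
        = sum_mset (image_mset code_deg (mset (sorted_list_of_multiset (image_mset g m))))"
      by (metis mset_map sum_mset_sum_list)
    also have "\<dots> = mdeg deg m"
      by (simp add: mdeg_def deg_def multiset.map_comp comp_def)
    finally show ?thesis .
  qed
  ultimately have "cone_generators X deg r s" by unfold_locales
  then show ?thesis by blast
qed

section \<open>The Hochschild double complex on basis elements\<close>

text \<open>In the normalised complex a tensor with a unit after the first position is zero.\<close>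

definition bas :: "'x multiset list \<Rightarrow> ('x multiset list \<Rightarrow>\<^sub>0 'k::comm_ring_1)" where
  "bas ms = (if {#} \<in> set (tl ms) then 0 else single ms 1)"

text \<open>A tensor of monomials with one arbitrary entry \<open>f\<close>; every summand in either
  boundary of a basis element has this shape.\<close>

definition slot ::
  "'x multiset list \<Rightarrow> ('x multiset \<Rightarrow>\<^sub>0 'k) \<Rightarrow> 'x multiset list
    \<Rightarrow> ('x multiset list \<Rightarrow>\<^sub>0 'k::comm_ring_1)" where
  "slot l f l' = lin_ext (\<lambda>m. bas (l @ m # l')) f"

lemma linear_slot [linear_intros]: "linear_map F \<Longrightarrow> linear_map (\<lambda>f. slot l (F f) l')"
  unfolding slot_def by (rule linear_intros)

lemma slot_zero [simp]: "slot l 0 l' = 0"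
  by (rule linear_map_0[OF linear_slot[OF linear_ident]])

lemma slot_single [simp]: "slot l (single m c) l' = pscale c (bas (l @ m # l'))"
  by (simp add: slot_def)

lemma listset_iff: "ys \<in> listset As \<longleftrightarrow> list_all2 (\<in>) ys As"
  by (induction As arbitrary: ys) (auto simp: set_Cons_def list_all2_Cons2)

lemma list_all2_singletons: "list_all2 (\<in>) ys (map (\<lambda>m. {m}) l) \<longleftrightarrow> ys = l"
  by (induction l arbitrary: ys) (auto simp: list_all2_Cons2)

lemma list_all2_slot:
  "list_all2 (\<in>) ys (map (\<lambda>m. {m}) l @ A # map (\<lambda>m. {m}) l') \<longleftrightarrow> (\<exists>m\<in>A. ys = l @ m # l')"
  by (induction l arbitrary: ys) (auto simp: list_all2_Cons2 list_all2_singletons)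

lemma prod_list_single:
  "prod_list (map2 lookup (map (\<lambda>m. single m (1::'k::comm_ring_1)) l) l) = 1"
  by (induction l) auto

lemma prod_nth_map2:
  "length as = length bs \<Longrightarrow> (\<Prod>i<length as. g (as ! i) (bs ! i)) = prod_list (map2 g as bs)"
  by (simp add: prod.list_conv_set_nth atLeast0LessThan)

text \<open>With monomials in all other positions, the index set of \<open>tens\<close> corresponds
  to the support of \<open>f\<close>, and each product of coefficients reduces to one coefficient of
  \<open>f\<close>.\<close>

lemma tens_slot:
  fixes f :: "'x multiset \<Rightarrow>\<^sub>0 'k::comm_ring_1"
  shows "tens (map (\<lambda>m. single m 1) l @ f # map (\<lambda>m. single m 1) l') = slot l f l'"
proof -
  let ?as = "map (\<lambda>m. single m (1::'k)) l @ f # map (\<lambda>m. single m 1) l'"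
  let ?g = "\<lambda>m. l @ m # l'"
  have S: "listset (map keys ?as) = ?g ` keys f"
    by (auto simp: listset_iff list_all2_slot comp_def)
  have P: "(\<Prod>i<length ?as. lookup (?as ! i) (?g m ! i)) = lookup f m" for m
  proof -
    have "(\<Prod>i<length ?as. lookup (?as ! i) (?g m ! i)) = prod_list (map2 lookup ?as (?g m))"
      by (rule prod_nth_map2) simp
    then show ?thesis by (simp add: prod_list_single)
  qed
  have "tens ?as = (\<Sum>ms \<in> ?g ` {m \<in> keys f. {#} \<notin> set (tl (?g m))}.
      single ms (\<Prod>i<length ?as. lookup (?as ! i) (ms ! i)))"
    unfolding tens_def S by (rule sum.cong) auto
  also have "\<dots> = (\<Sum>m \<in> {m \<in> keys f. {#} \<notin> set (tl (?g m))}. single (?g m) (lookup f m))"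
    by (subst sum.reindex) (auto simp: inj_on_def P simp del: length_append)
  also have "\<dots> = (\<Sum>m \<in> keys f. pscale (lookup f m) (bas (?g m)))"
    by (rule sum.mono_neutral_cong_left) (auto simp: bas_def)
  finally show ?thesis by (simp add: slot_def lin_ext_def)
qed

lemma hh_b_basis_slot:
  assumes "length ms = Suc q" "q > 0"
  shows "(hh_b_basis deg r ms :: _ \<Rightarrow>\<^sub>0 'k::comm_ring_1) =
    (\<Sum>i<q. pscale ((-1) ^ i)
       (slot (take i ms) (mono_mul deg r (ms ! i) (ms ! Suc i)) (drop (i + 2) ms)))
    + pscale ((-1) ^ (q + mdeg deg (ms ! q) * sum_list (map (mdeg deg) (take q ms))))
       (slot [] (mono_mul deg r (ms ! q) (ms ! 0)) (take (q - 1) (tl ms)))"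
proof -
  let ?as = "map (\<lambda>m. single m (1::'k)) ms"
  have "tens (take i ?as @ [lam_mul deg r (?as ! i) (?as ! Suc i)] @ drop (i + 2) ?as)
      = slot (take i ms) (mono_mul deg r (ms ! i) (ms ! Suc i)) (drop (i + 2) ms)" if "i < q" for i
    using that assms tens_slot[of "take i ms" _ "drop (i + 2) ms"] by (simp add: take_map drop_map)
  moreover have "tens (lam_mul deg r (?as ! q) (?as ! 0) # take (q - 1) (tl ?as))
      = slot [] (mono_mul deg r (ms ! q) (ms ! 0)) (take (q - 1) (tl ms))"
    using assms tens_slot[of "[]" _ "take (q - 1) (tl ms)"] by (simp add: take_map flip: map_tl)
  ultimately show ?thesis using assms by (simp add: hh_b_basis_def Let_def)
qed

lemma hh_d_basis_slot:
  assumes "length ms = Suc q"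
  shows "(hh_d_basis deg d ms :: _ \<Rightarrow>\<^sub>0 'k::comm_ring_1) =
    pscale ((-1) ^ q) (\<Sum>i\<le>q. pscale ((-1) ^ sum_list (map (mdeg deg) (take i ms)))
       (slot (take i ms) (d (single (ms ! i) 1)) (drop (Suc i) ms)))"
proof -
  let ?as = "map (\<lambda>m. single m (1::'k)) ms"
  have "tens (?as[i := d (?as ! i)]) = slot (take i ms) (d (single (ms ! i) 1)) (drop (Suc i) ms)"
    if "i \<le> q" for i
    using that assms tens_slot[of "take i ms" _ "drop (Suc i) ms"]
    by (simp add: upd_conv_take_nth_drop take_map drop_map)
  then show ?thesis using assms by (simp add: hh_d_basis_def Let_def)
qed

lemma linear_hh_total [linear_intros]:
  "linear_map F \<Longrightarrow> linear_map (\<lambda>f. hh_total deg r d (F f))"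
  unfolding hh_total_def by (intro linear_intros)

lemma bas_eq_single: "{#} \<notin> set (tl ms) \<Longrightarrow> bas ms = single ms 1"
  by (simp add: bas_def)

lemma lookup_bas: "lookup (bas ms) K = (if ms = K \<and> {#} \<notin> set (tl K) then 1 else 0)"
  by (auto simp: bas_def lookup_single when_def)

lemma lookup_slot_zero:
  assumes "\<And>m. m \<in> keys f \<Longrightarrow> K \<noteq> l @ m # l'"
  shows "lookup (slot l f l') K = 0"
proof -
  have "lookup (bas (l @ m # l')) K = (0 :: 'b)" if "m \<in> keys f" for m
    using assms[OF that] by (simp add: lookup_bas)
  then show ?thesis by (simp add: slot_def lin_ext_def lookup_sum)
qed

section \<open>The column filtration and its subquotients\<close>

lemma hh_filt_zero [simp]: "0 \<in> hh_filt X deg p n"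
  by (simp add: hh_filt_def)

lemma hh_filt_diff:
  "\<lbrakk>x \<in> hh_filt X deg p n; y \<in> hh_filt X deg p n\<rbrakk> \<Longrightarrow> x - y \<in> hh_filt X deg p n"
  using keys_diff[of x y] unfolding hh_filt_def by blast

lemma hh_filt_add:
  "\<lbrakk>x \<in> hh_filt X deg p n; y \<in> hh_filt X deg p n\<rbrakk> \<Longrightarrow> x + y \<in> hh_filt X deg p n"
  using keys_add[of x y] unfolding hh_filt_def by blast

lemma hh_filt_pscale: "x \<in> hh_filt X deg p n \<Longrightarrow> pscale c x \<in> hh_filt X deg p n"
  using keys_pscale[of c x] unfolding hh_filt_def by blast

lemma hh_filt_sum:
  "(\<And>i. i \<in> I \<Longrightarrow> f i \<in> hh_filt X deg p n) \<Longrightarrow> (\<Sum>i\<in>I. f i) \<in> hh_filt X deg p n"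
  by (induction I rule: infinite_finite_induct) (auto intro: hh_filt_add)

lemma hh_filtI:
  "\<lbrakk>keys x \<subseteq> hh_basis X deg p q; int p + int q = n; int p \<le> s\<rbrakk> \<Longrightarrow> x \<in> hh_filt X deg s n"
  unfolding hh_filt_def by blast

lemma hh_filtD:
  assumes "x \<in> hh_filt X deg s n" "ms \<in> keys x"
  obtains p q where "ms \<in> hh_basis X deg p q" "int p + int q = n" "int p \<le> s"
  using assms unfolding hh_filt_def by blast

lemma hh_filt_lookup:
  assumes "x \<in> hh_filt X deg s n" "int (sum_list (map (mdeg deg) ms)) > s"
  shows "lookup x ms = 0"
proof (rule ccontr)
  assume "lookup x ms \<noteq> 0"
  then have "ms \<in> keys x" by (simp add: in_keys_iff)
  then obtain p q where "ms \<in> hh_basis X deg p q" "int p \<le> s"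
    using hh_filtD[OF assms(1)] by metis
  then show False using assms(2) by (simp add: hh_basis_def)
qed

lemma hh_B_diff:
  assumes "x \<in> hh_B X deg r d k p q" "y \<in> hh_B X deg r d k p q"
  shows "x - y \<in> hh_B X deg r d k p q"
proof -
  obtain x1 x2 y1 y2 where *: "x = hh_total deg r d x1 + x2" "y = hh_total deg r d y1 + y2"
    "x1 \<in> hh_A X deg r d (k - 1) (p + int k - 1) (p + q + 1)" "x2 \<in> hh_filt X deg (p - 1) (p + q)"
    "y1 \<in> hh_A X deg r d (k - 1) (p + int k - 1) (p + q + 1)" "y2 \<in> hh_filt X deg (p - 1) (p + q)"
    using assms unfolding hh_B_def by blast
  have lin: "hh_total deg r d (x1 - y1) = hh_total deg r d x1 - hh_total deg r d y1"
    by (rule linear_map_diff[OF linear_hh_total[OF linear_ident]])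
  have "x - y = hh_total deg r d (x1 - y1) + (x2 - y2)" using * lin by simp
  moreover have "x1 - y1 \<in> hh_A X deg r d (k - 1) (p + int k - 1) (p + q + 1)"
    using * by (auto simp: hh_A_def lin hh_filt_diff)
  moreover have "x2 - y2 \<in> hh_filt X deg (p - 1) (p + q)" using * by (simp add: hh_filt_diff)
  ultimately show ?thesis unfolding hh_B_def by blast
qed

text \<open>The coset of \<open>c\<close> on the right contains both \<open>c\<close> and
  \<open>0\<close>. Read as a coset on the left, it forces their difference into
  \<open>B\<close>.\<close>

lemma subquot_eqD:
  assumes "subquot Z B = subquot Z' B'" "c \<in> Z'" "0 \<in> Z'" "c \<in> B'" "0 \<in> B'"
    and diff: "\<And>x y. \<lbrakk>x \<in> B; y \<in> B\<rbrakk> \<Longrightarrow> x - y \<in> B"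
  shows "c \<in> B"
proof -
  let ?C = "{(x, y). x \<in> Z' \<and> y \<in> Z' \<and> x - y \<in> B'} `` {c}"
  have "?C \<in> subquot Z' B'" using assms(2) by (auto simp: subquot_def quotient_def)
  then have "?C \<in> subquot Z B" using assms(1) by simp
  then obtain z where z: "?C = {(x, y). x \<in> Z \<and> y \<in> Z \<and> x - y \<in> B} `` {z}"
    by (auto simp: subquot_def quotient_def)
  have "c \<in> ?C" "0 \<in> ?C" using assms by auto
  then have "z - c \<in> B" "z - 0 \<in> B" unfolding z by auto
  then have "(z - 0) - (z - c) \<in> B" using diff by blast
  then show ?thesis by simp
qed

section \<open>The class of \<open>1 \<otimes> y \<otimes> \<dots> \<otimes> y\<close>\<close>

context cone_algebra
begin

abbreviation Y :: "'x multiset" where "Y \<equiv> {#gy#}"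
abbreviation hb :: "('x multiset list \<Rightarrow>\<^sub>0 'k) \<Rightarrow> ('x multiset list \<Rightarrow>\<^sub>0 'k)" where
  "hb \<equiv> lin_ext (hh_b_basis deg r)"
abbreviation hdd :: "('x multiset list \<Rightarrow>\<^sub>0 'k) \<Rightarrow> ('x multiset list \<Rightarrow>\<^sub>0 'k)" where
  "hdd \<equiv> lin_ext (hh_d_basis deg dd)"
abbreviation tot where "tot \<equiv> hh_total deg r dd"

text \<open>The tensor a \<otimes> y \<otimes> ... \<otimes> y \<otimes> z with \<open>l\<close>
  factors y, bilinear in \<open>a\<close> and \<open>z\<close>.\<close>

definition T where
  "T l a z = lin_ext (\<lambda>m. slot (m # replicate l Y) z []) (a :: 'x multiset \<Rightarrow>\<^sub>0 'k)"

lemma linear_T [linear_intros]: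
  "linear_map F \<Longrightarrow> linear_map (\<lambda>f. T l (F f) z)" "linear_map F \<Longrightarrow> linear_map (\<lambda>f. T l a (F f))"
  unfolding T_def by (intro linear_lin_ext_arg linear_intros | assumption)+

lemmas T_zero = linear_map_0[OF linear_T(1)[OF linear_ident]]
  linear_map_0[OF linear_T(2)[OF linear_ident]]
lemmas T_minus = linear_map_uminus[OF linear_T(1)[OF linear_ident]]
  linear_map_uminus[OF linear_T(2)[OF linear_ident]]
lemmas T_sum = linear_map_sum[OF linear_T(1)[OF linear_ident]]
  linear_map_sum[OF linear_T(2)[OF linear_ident]]

lemma slot_first: "slot [] f (replicate l Y @ [m]) = T l f (mon m)"
  by (simp add: T_def slot_def)

lemma slot_last: "slot (m # replicate l Y) f [] = T l (mon m) f"
  by (simp add: T_def)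

lemma T_mon: "T l (mon m) (mon m') = bas (m # replicate l Y @ [m'])"
  by (simp add: T_def)

lemma mono_mul_YY: "mono_mul deg r Y Y = 0"
  by (simp add: mono_mul_alt)

text \<open>Serves both boundaries of \<open>T l a z\<close>: the terms between the ends vanish
  because yy = 0 and \<partial>y = 0.\<close>

lemma sum_lessThan_ends:
  fixes f :: "nat \<Rightarrow> 'a::comm_monoid_add"
  assumes "\<And>i. \<lbrakk>0 < i; i \<le> l\<rbrakk> \<Longrightarrow> f i = 0"
  shows "(\<Sum>i<Suc (Suc l). f i) = f 0 + f (Suc l)"
proof -
  have "(\<Sum>i<Suc l. f i) = (\<Sum>i\<in>{0}. f i)"
    by (rule sum.mono_neutral_right) (use assms in auto)
  then show ?thesis by simp
qed

text \<open>The two products at the ends and the cyclic term remain. As \<open>m'\<close> has even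
  degree, the cyclic term has no Koszul sign, only \<open>(-1) ^ (l + 2)\<close>.\<close>

lemma hb_T_mon:
  assumes m: "m \<in> M" "m' \<in> M" "m' \<noteq> {#}" "even (ndeg m')"
  shows "hb (T (Suc l) (mon m) (mon m')) = T l (mon m \<cdot> mon Y) (mon m')
    + pscale ((-1) ^ Suc l) (T l (mon m) (mon Y \<cdot> mon m')) + pscale ((-1) ^ l) (T l (mon m' \<cdot> mon m) (mon Y))"
proof -
  let ?ms = "m # replicate (Suc l) Y @ [m']"
  let ?t = "\<lambda>i. pscale ((-1) ^ i) (slot (take i ?ms) (mono_mul deg r (?ms ! i) (?ms ! Suc i))
    (drop (i + 2) ?ms)) :: _ \<Rightarrow>\<^sub>0 'k"
  have "hb (T (Suc l) (mon m) (mon m')) = hh_b_basis deg r ?ms"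
    using m(3) by (simp add: T_mon bas_eq_single del: replicate_Suc)
  also have "\<dots> = (\<Sum>i<Suc (Suc l). ?t i)
    + pscale ((-1) ^ (Suc (Suc l) + ndeg (?ms ! Suc (Suc l)) * sum_list (map ndeg (take (Suc (Suc l)) ?ms))))
       (slot [] (mono_mul deg r (?ms ! Suc (Suc l)) (?ms ! 0)) (take (Suc l) (tl ?ms)))"
    by (subst hh_b_basis_slot[of _ "Suc (Suc l)"]) simp_all
  also have "(\<Sum>i<Suc (Suc l). ?t i) = ?t 0 + ?t (Suc l)"
  proof (rule sum_lessThan_ends)
    fix i assume "0 < i" "i \<le> l"
    then have "?ms ! i = Y" "?ms ! Suc i = Y"
      by (auto simp: nth_Cons' nth_append simp del: replicate_Suc)
    then show "?t i = 0" by (simp only: mono_mul_YY slot_zero pscale_simps)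
  qed
  also have "?t 0 = T l (mon m \<cdot> mon Y) (mon m')"
    by (simp add: slot_first)
  also have "?t (Suc l) = pscale ((-1) ^ Suc l) (T l (mon m) (mon Y \<cdot> mon m'))"
  proof -
    have "?ms = (m # replicate l Y) @ [Y, m']" by (simp flip: replicate_append_same)
    then have "take (Suc l) ?ms = m # replicate l Y" by (simp only: take_append) simp
    moreover have "?ms ! Suc l = Y" "?ms ! Suc (Suc l) = m'"
      by (simp_all add: nth_append del: replicate_Suc)
    moreover have "drop (Suc l + 2) ?ms = []" by simp
    ultimately show ?thesis by (simp only: slot_last lam_mul_single mult_1_left pscale_simps)
  qed
  also have "slot [] (mono_mul deg r (?ms ! Suc (Suc l)) (?ms ! 0)) (take (Suc l) (tl ?ms))
      = T l (mon m' \<cdot> mon m) (mon Y)"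
  proof -
    have "take (Suc l) (tl ?ms) = replicate l Y @ [Y]"
      by (simp add: replicate_append_same)
    moreover have "?ms ! Suc (Suc l) = m'" "?ms ! 0 = m"
      by (simp_all add: nth_append del: replicate_Suc)
    ultimately show ?thesis by (simp only: slot_first lam_mul_single mult_1_left pscale_simps)
  qed
  also have "(-1 :: 'k) ^ (Suc (Suc l) + ndeg (?ms ! Suc (Suc l)) * sum_list (map ndeg (take (Suc (Suc l)) ?ms)))
      = (-1) ^ l"
    using m(4) by (intro neg_one_power_cong) (simp add: nth_append)
  finally show ?thesis .
qed

lemma hb_T:
  assumes "keys a \<subseteq> M" "\<And>m. m \<in> keys z \<Longrightarrow> m \<in> M \<and> m \<noteq> {#} \<and> even (ndeg m)"
  shows "hb (T (Suc l) a z) = T l (a \<cdot> mon Y) z + pscale ((-1) ^ Suc l) (T l a (mon Y \<cdot> z))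
    + pscale ((-1) ^ l) (T l (z \<cdot> a) (mon Y))"
proof (rule linear_map_eqI[where f = a])
  fix m assume m: "m \<in> keys a"
  show "hb (T (Suc l) (mon m) z) = T l (mon m \<cdot> mon Y) z + pscale ((-1) ^ Suc l) (T l (mon m) (mon Y \<cdot> z))
    + pscale ((-1) ^ l) (T l (z \<cdot> mon m) (mon Y))"
    by (rule linear_map_eqI[where f = z], (intro linear_intros)+, rule hb_T_mon)
      (use m assms in auto)
qed (intro linear_intros)+

text \<open>With two tensor factors \<open>b\<close> is a graded commutator.\<close>

lemma hb_T_0:
  assumes "keys a \<subseteq> M" "\<And>m. m \<in> keys z \<Longrightarrow> m \<in> M \<and> m \<noteq> {#} \<and> even (ndeg m)"
  shows "hb (T 0 a z) = 0"
proof (rule linear_map_eqI[of "\<lambda>a. hb (T 0 a z)" "\<lambda>a. 0"])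
  fix m assume m: "m \<in> keys a"
  show "hb (T 0 (mon m) z) = 0"
  proof (rule linear_map_eqI[of "\<lambda>z. hb (T 0 (mon m) z)" "\<lambda>z. 0"])
    fix m' assume m': "m' \<in> keys z"
    have "hb (T 0 (mon m) (mon m')) = hh_b_basis deg r [m, m']"
      using assms(2)[OF m'] by (simp add: T_mon bas_eq_single)
    also have "\<dots> = slot [] (mono_mul deg r m m') []
        + pscale ((-1) ^ (1 + ndeg m' * ndeg m)) (slot [] (mono_mul deg r m' m) [])"
      by (subst hh_b_basis_slot[of _ 1]) simp_all
    also have "mono_mul deg r m' m = (mono_mul deg r m m' :: _ \<Rightarrow>\<^sub>0 'k)"
      using mono_mul_commute[OF lin_ord, of m deg m', where 'k = 'k] subsetD[OF assms(1) m]
        assms(2)[OF m'] by auto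
    also have "(-1 :: 'k) ^ (1 + ndeg m' * ndeg m) = -1" using assms(2)[OF m'] by simp
    finally show "hb (T 0 (mon m) (mon m')) = 0" by simp
  qed (intro linear_intros)+
qed (intro linear_intros)+

text \<open>Passing the \<open>l\<close> factors y gives \<open>(-1) ^ l\<close> at the last
  position; together with the column sign \<open>(-1) ^ Suc l\<close> this is -1.\<close>

lemma hd_T_mon:
  assumes m: "m \<in> M" "m' \<in> M" "m' \<noteq> {#}" "even (ndeg m)"
  shows "hdd (T l (mon m) (mon m'))
    = pscale ((-1) ^ Suc l) (T l (dm m) (mon m')) - T l (mon m) (dm m')"
proof -
  let ?ms = "m # replicate l Y @ [m']"
  let ?t = "\<lambda>i. pscale ((-1) ^ sum_list (map ndeg (take i ?ms)))
    (slot (take i ?ms) (dd (mon (?ms ! i))) (drop (Suc i) ?ms)) :: _ \<Rightarrow>\<^sub>0 'k"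
  have "hdd (T l (mon m) (mon m')) = hh_d_basis deg dd ?ms"
    using m(3) by (simp add: T_mon bas_eq_single)
  also have "\<dots> = pscale ((-1) ^ Suc l) (\<Sum>i<Suc (Suc l). ?t i)"
    by (subst hh_d_basis_slot[of _ "Suc l"])
      (simp_all add: lessThan_Suc_atMost del: sum.lessThan_Suc sum.atMost_Suc)
  also have "(\<Sum>i<Suc (Suc l). ?t i) = ?t 0 + ?t (Suc l)"
  proof (rule sum_lessThan_ends)
    fix i assume "0 < i" "i \<le> l"
    then have "?ms ! i = Y" by (auto simp: nth_Cons' nth_append)
    moreover have "dd (mon Y) = 0" by simp
    ultimately show "?t i = 0" by (simp only: slot_zero pscale_simps)
  qed
  also have "?t 0 = T l (dm m) (mon m')"
    by (simp add: slot_first)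
  also have "?t (Suc l) = pscale ((-1) ^ l) (T l (mon m) (dm m'))"
  proof -
    have "take (Suc l) ?ms = m # replicate l Y" "?ms ! Suc l = m'" "drop (Suc (Suc l)) ?ms = []"
      by (simp_all add: nth_append)
    moreover have "(-1 :: 'k) ^ sum_list (map ndeg (m # replicate l Y)) = (-1) ^ l"
      using m(4) by (intro neg_one_power_cong) (simp add: sum_list_replicate)
    ultimately show ?thesis by (simp only: slot_last der_single pscale_simps)
  qed
  finally show ?thesis by (simp add: pscale_add_right pscale_minus_left)
qed

lemma hd_T:
  assumes "\<And>m. m \<in> keys a \<Longrightarrow> m \<in> M \<and> even (ndeg m)" "keys z \<subseteq> M - {{#}}"
  shows "hdd (T l a z) = pscale ((-1) ^ Suc l) (T l (dd a) z) - T l a (dd z)"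
proof (rule linear_map_eqI[where f = a])
  fix m assume m: "m \<in> keys a"
  show "hdd (T l (mon m) z) = pscale ((-1) ^ Suc l) (T l (dd (mon m)) z) - T l (mon m) (dd z)"
  proof (rule linear_map_eqI[where f = z])
    fix m' assume "m' \<in> keys z"
    then show "hdd (T l (mon m) (mon m'))
        = pscale ((-1) ^ Suc l) (T l (dd (mon m)) (mon m')) - T l (mon m) (dd (mon m'))"
      using hd_T_mon[of m m' l] assms m by (auto simp del: power_Suc)
  qed (intro linear_intros)+
qed (intro linear_intros)+

lemma T_filt:
  assumes "a \<in> homog X deg p" "z \<in> homog X deg p'" "q = Suc l" "p'' = p + l + p'"
  shows "keys (T l a z) \<subseteq> hh_basis X deg p'' q"
proof (rule keys_linear_map[of "\<lambda>a. T l a z"])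
  fix m assume m: "m \<in> keys a"
  show "keys (T l (mon m) z) \<subseteq> hh_basis X deg p'' q"
  proof (rule keys_linear_map[of "\<lambda>z. T l (mon m) z"])
    fix m' assume m': "m' \<in> keys z"
    show "keys (T l (mon m) (mon m')) \<subseteq> hh_basis X deg p'' q"
      using homog_lookupD[OF assms(1) m] homog_lookupD[OF assms(2) m'] assms(3,4)
      by (auto simp: T_mon bas_def hh_basis_def sum_list_replicate)
  qed (intro linear_intros)+
qed (intro linear_intros)+

text \<open>
  \<open>dp j\<close> plays the role of the divided power \<open>x\<^sup>j/j!\<close>, and \<open>\<Sum>\<^sub>j ip j t\<^sup>j\<close> is the inverse
  of the power series \<open>\<Sum>\<^sub>j dp j t\<^sup>j\<close>.
\<close>

primrec dp :: "nat \<Rightarrow> ('x multiset \<Rightarrow>\<^sub>0 'k)" where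
  "dp 0 = mon {#}"
| "dp (Suc j) = cone s (mon Y \<cdot> dp j)"

lemma mon_Y: "mon Y \<in> homog X deg 1"
  by (simp add: single_homog)

lemma YY_mult: "mon Y \<cdot> (mon Y \<cdot> f) = 0"
  by (simp add: mono_mul_YY flip: lam_mul_assoc)

lemma dp_homog: "dp j \<in> homog X deg (2 * j)"
proof (induction j)
  case (Suc j)
  then show ?case using cone_homog[OF homog_lam_mul[OF mon_Y Suc]] by simp
qed (simp add: single_homog)

lemma homog_keys: "f \<in> homog X deg p \<Longrightarrow> keys f \<subseteq> M"
  by (auto simp: homog_def)

lemma der_Y_mult:
  assumes "keys f \<subseteq> M" shows "dd (mon Y \<cdot> f) = - (mon Y \<cdot> dd f)"
  using leibniz[OF mon_Y assms] by simp

text \<open>The contraction turns a cycle into the boundary of its image, so it suffices that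
  \<open>mon Y \<cdot> dp j\<close> is a cycle; inductively its boundary contains the factor yy =
  0.\<close>

lemma der_dp_Suc: "dd (dp (Suc j)) = mon Y \<cdot> dp j"
proof -
  have "dd (mon Y \<cdot> dp j) = 0"
  proof (induction j)
    case (Suc j)
    have "dd (dp (Suc j)) = mon Y \<cdot> dp j"
      using cycle_is_boundary[OF homog_lam_mul[OF mon_Y dp_homog] _ Suc] by simp
    then show ?case
      using der_Y_mult[OF homog_keys[OF dp_homog[of "Suc j"]]]
      by (simp only: YY_mult minus_zero)
  qed simp
  then show ?thesis
    using cycle_is_boundary[OF homog_lam_mul[OF mon_Y dp_homog], of j] by simp
qed

text \<open>The conditional inside the sum shows the bound \<open>i < j\<close> to the termination
  proof; \<open>ip_eq\<close> is the recursion without it.\<close>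

fun ip :: "nat \<Rightarrow> ('x multiset \<Rightarrow>\<^sub>0 'k)" where
  "ip j = (if j = 0 then mon {#} else - (\<Sum>i<j. if i < j then dp (j - i) \<cdot> ip i else 0))"

declare ip.simps [simp del]

lemma ip_0 [simp]: "ip 0 = mon {#}"
  by (simp add: ip.simps)

lemma dp_ip: "j > 0 \<Longrightarrow> (\<Sum>i\<le>j. dp (j - i) \<cdot> ip i) = 0"
proof -
  assume "j > 0"
  have "(\<Sum>i<j. if i < j then dp (j - i) \<cdot> ip i else 0) = (\<Sum>i<j. dp (j - i) \<cdot> ip i)"
    by (rule sum.cong) auto
  then have "ip j = - (\<Sum>i<j. dp (j - i) \<cdot> ip i)"
    using \<open>j > 0\<close> by (simp add: ip.simps[of j])
  moreover have "(\<Sum>i\<le>j. dp (j - i) \<cdot> ip i) = (\<Sum>i<j. dp (j - i) \<cdot> ip i) + ip j"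
    by (simp flip: lessThan_Suc_atMost)
  ultimately show ?thesis by simp
qed

lemma ip_eq: "j > 0 \<Longrightarrow> ip j = - (\<Sum>i<j. dp (j - i) \<cdot> ip i)"
  using dp_ip[of j] by (simp add: add_eq_0_iff flip: lessThan_Suc_atMost)

lemma ip_homog: "ip j \<in> homog X deg (2 * j)"
proof (induction j rule: less_induct)
  case (less j)
  show ?case
  proof (cases "j = 0")
    case False
    have "dp (j - i) \<cdot> ip i \<in> homog X deg (2 * j)" if "i < j" for i
    proof -
      have "dp (j - i) \<cdot> ip i \<in> homog X deg (2 * (j - i) + 2 * i)"
        by (intro homog_lam_mul dp_homog less that)
      then show ?thesis using that by (simp add: algebra_simps)
    qed
    then have "- (\<Sum>i<j. dp (j - i) \<cdot> ip i) \<in> homog X deg (2 * j)"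
      by (intro homog_uminus homog_sum) auto
    then show ?thesis using ip_eq[of j] False by simp
  qed (simp add: single_homog)
qed

lemma Y_commute: "f \<in> homog X deg (2 * j) \<Longrightarrow> f \<cdot> mon Y = mon Y \<cdot> f"
  using lam_mul_commute[OF lin_ord mon_Y, of f "2 * j"] by simp

lemma ip_dp_commute: "ip i \<cdot> dp j = dp j \<cdot> ip i"
  using lam_mul_commute[OF lin_ord dp_homog[of j] ip_homog[of i]] by simp

lemma der_dp_mult:
  assumes "keys f \<subseteq> M"
  shows "dd (dp j \<cdot> f) = dd (dp j) \<cdot> f + dp j \<cdot> dd f"
  using leibniz[OF dp_homog assms, of j] by simp

text \<open>The series P of the \<open>dp j\<close> satisfies \<partial>P = t y P, so its inverse Q
  satisfies \<partial>Q = - t y Q. The proof differentiates the recursion for the coefficients, and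
  by induction all terms but the last cancel.\<close>

lemma der_ip_Suc: "dd (ip (Suc j)) = - (mon Y \<cdot> ip j)"
proof (induction j rule: less_induct)
  case (less j)
  have "dd (ip (Suc j)) = - (\<Sum>i<Suc j. dd (dp (Suc j - i) \<cdot> ip i))"
    using ip_eq[of "Suc j"] by (simp only: der_minus der_sum zero_less_Suc)
  also have "(\<Sum>i<Suc j. dd (dp (Suc j - i) \<cdot> ip i))
      = (\<Sum>i<Suc j. mon Y \<cdot> (dp (j - i) \<cdot> ip i)) + (\<Sum>i<Suc j. dp (Suc j - i) \<cdot> dd (ip i))"
  proof -
    have "dd (dp (Suc j - i) \<cdot> ip i) = mon Y \<cdot> (dp (j - i) \<cdot> ip i) + dp (Suc j - i) \<cdot> dd (ip i)"
      if "i < Suc j" for i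
      using der_dp_mult[OF homog_keys[OF ip_homog[of i]], of "Suc j - i"] that
      by (simp add: Suc_diff_le der_dp_Suc lam_mul_assoc del: dp.simps)
    then show ?thesis by (simp add: sum.distrib del: sum.lessThan_Suc)
  qed
  also have "(\<Sum>i<Suc j. dp (Suc j - i) \<cdot> dd (ip i)) = (\<Sum>i<j. dp (Suc j - Suc i) \<cdot> dd (ip (Suc i)))"
    by (subst sum.lessThan_Suc_shift) simp
  also have "\<dots> = - (mon Y \<cdot> (\<Sum>i<j. dp (j - i) \<cdot> ip i))"
  proof -
    have "dp (j - i) \<cdot> (mon Y \<cdot> ip i) = mon Y \<cdot> (dp (j - i) \<cdot> ip i)" for i
      using Y_commute[OF dp_homog[of "j - i"]] by (simp flip: lam_mul_assoc)
    then show ?thesis using less by (simp add: lam_mul_sum sum_negf del: dp.simps)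
  qed
  also have "(\<Sum>i<Suc j. mon Y \<cdot> (dp (j - i) \<cdot> ip i)) + - (mon Y \<cdot> (\<Sum>i<j. dp (j - i) \<cdot> ip i))
      = mon Y \<cdot> ip j"
    by (simp add: lam_mul_sum)
  finally show ?case .
qed

text \<open>The part of the bounding chain with \<open>l\<close> factors y. It has bidegree (2j + l,
  l + 1).\<close>

definition V where "V l j = (\<Sum>i\<in>{1..j}. T l (dp (j - i)) (ip i))"

lemma ip_keys: "\<lbrakk>i > 0; m \<in> keys (ip i)\<rbrakk> \<Longrightarrow> m \<in> M \<and> m \<noteq> {#} \<and> even (ndeg m)"
  using homog_lookupD[OF ip_homog, of m i] by auto

lemma dp_keys: "m \<in> keys (dp i) \<Longrightarrow> m \<in> M \<and> even (ndeg m)"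
  using homog_lookupD[OF dp_homog, of m i] by auto

lemma hb_V_0: "hb (V 0 j) = 0"
proof -
  have "hb (T 0 (dp (j - i)) (ip i)) = 0" if "i \<in> {1..j}" for i
    by (rule hb_T_0) (use that ip_keys[of i] dp_keys[of _ "j - i"] in \<open>auto simp: Suc_le_eq\<close>)
  then show ?thesis by (simp add: V_def linear_map_sum[OF linear_lin_ext])
qed

lemma hd_V:
  "hdd (V l j) = pscale ((-1) ^ Suc l) (\<Sum>i\<in>{1..j}. T l (dd (dp (j - i))) (ip i))
     + (\<Sum>i<j. T l (dp (j - Suc i)) (mon Y \<cdot> ip i))"
proof -
  have "hdd (T l (dp (j - i)) (ip i))
      = pscale ((-1) ^ Suc l) (T l (dd (dp (j - i))) (ip i)) - T l (dp (j - i)) (dd (ip i))"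
    if "i \<in> {1..j}" for i
    by (rule hd_T) (use that ip_keys[of i] dp_keys[of _ "j - i"] in \<open>auto simp: Suc_le_eq\<close>)
  then have "hdd (V l j) = pscale ((-1) ^ Suc l) (\<Sum>i\<in>{1..j}. T l (dd (dp (j - i))) (ip i))
      - (\<Sum>i\<in>{1..j}. T l (dp (j - i)) (dd (ip i)))"
    by (simp add: V_def linear_map_sum[OF linear_lin_ext] sum_subtractf pscale_sum del: power_Suc)
  also have "(\<Sum>i\<in>{1..j}. T l (dp (j - i)) (dd (ip i)))
      = (\<Sum>i<j. T l (dp (j - Suc i)) (dd (ip (Suc i))))"
    by (rule sum.reindex_bij_witness[of _ Suc "\<lambda>i. i - 1"]) auto
  also have "\<dots> = - (\<Sum>i<j. T l (dp (j - Suc i)) (mon Y \<cdot> ip i))"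
    by (simp only: der_ip_Suc T_minus sum_negf)
  finally show ?thesis by simp
qed

text \<open>Matches the b-boundary of one part with the internal boundary of the next. The cyclic
  terms carry the sum of \<open>dp (j - i) \<cdot> ip i\<close> without \<open>i = 0\<close>, which
  is \<open>- dp j\<close> since the series are inverse; this supplies the term \<open>i = 0\<close>
  on the other side.\<close>

lemma hb_V:
  assumes "j > 0"
  shows "hb (V (Suc l) j) = pscale ((-1) ^ Suc l) (hdd (V l (Suc j)))"
proof -
  let ?S1 = "\<Sum>i\<in>{1..j}. T l (mon Y \<cdot> dp (j - i)) (ip i)"
  let ?S2 = "\<Sum>i\<in>{1..j}. T l (dp (j - i)) (mon Y \<cdot> ip i)"
  have "hb (T (Suc l) (dp (j - i)) (ip i)) = T l (mon Y \<cdot> dp (j - i)) (ip i)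
      + pscale ((-1) ^ Suc l) (T l (dp (j - i)) (mon Y \<cdot> ip i))
      + pscale ((-1) ^ l) (T l (dp (j - i) \<cdot> ip i) (mon Y))" if "i \<in> {1..j}" for i
  proof -
    have "hb (T (Suc l) (dp (j - i)) (ip i)) = T l (dp (j - i) \<cdot> mon Y) (ip i)
      + pscale ((-1) ^ Suc l) (T l (dp (j - i)) (mon Y \<cdot> ip i))
      + pscale ((-1) ^ l) (T l (ip i \<cdot> dp (j - i)) (mon Y))"
      by (rule hb_T) (use that ip_keys[of i] dp_keys[of _ "j - i"] in \<open>auto simp: Suc_le_eq\<close>)
    then show ?thesis by (simp only: Y_commute[OF dp_homog] ip_dp_commute)
  qed
  then have "hb (V (Suc l) j) = ?S1 + pscale ((-1) ^ Suc l) ?S2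
      + pscale ((-1) ^ l) (T l (\<Sum>i\<in>{1..j}. dp (j - i) \<cdot> ip i) (mon Y))"
    by (simp add: V_def linear_map_sum[OF linear_lin_ext] sum.distrib pscale_sum T_sum del: power_Suc)
  also have "(\<Sum>i\<in>{1..j}. dp (j - i) \<cdot> ip i) = - dp j"
  proof -
    have "{..j} = insert 0 {1..j}" by auto
    then show ?thesis using dp_ip[OF assms] by (simp add: eq_neg_iff_add_eq_0 add.commute)
  qed
  finally have L: "hb (V (Suc l) j) = ?S1 + pscale ((-1) ^ Suc l) (T l (dp j) (mon Y) + ?S2)"
    by (simp add: T_minus pscale_add_right pscale_minus_left algebra_simps)
  have 1: "(\<Sum>i\<in>{1..Suc j}. T l (dd (dp (Suc j - i))) (ip i)) = ?S1"
  proof -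
    have "(\<Sum>i\<in>{1..Suc j}. T l (dd (dp (Suc j - i))) (ip i))
        = (\<Sum>i\<in>{1..j}. T l (dd (dp (Suc j - i))) (ip i))"
      by (simp add: T_zero)
    also have "\<dots> = ?S1"
      by (rule sum.cong) (auto simp: Suc_diff_le der_dp_Suc simp del: dp.simps)
    finally show ?thesis .
  qed
  have 2: "(\<Sum>i<Suc j. T l (dp (Suc j - Suc i)) (mon Y \<cdot> ip i)) = T l (dp j) (mon Y) + ?S2"
  proof -
    have "{..<Suc j} = insert 0 {1..j}" by auto
    then show ?thesis by (simp del: lam_mul_single)
  qed
  have "hdd (V l (Suc j)) = pscale ((-1) ^ Suc l) ?S1 + (T l (dp j) (mon Y) + ?S2)"
    by (simp only: hd_V 1 2)
  then show ?thesis unfolding L by (simp add: pscale_add_right)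
qed

text \<open>The actual column is \<open>2 * j + l\<close>; the weaker bound depends only on
  \<open>j + l\<close>, which stays fixed along the staircase below.\<close>

lemma V_filt: "j > 0 \<Longrightarrow> V l j \<in> hh_filt X deg (int (2 * (j + l))) (int (2 * (j + l) + 1))"
  unfolding V_def
proof (intro hh_filt_sum)
  fix i assume i: "i \<in> {1..j}"
  have "keys (T l (dp (j - i)) (ip i)) \<subseteq> hh_basis X deg (2 * j + l) (Suc l)"
    by (rule T_filt[OF dp_homog ip_homog]) (use i in auto)
  then show "T l (dp (j - i)) (ip i) \<in> hh_filt X deg (int (2 * (j + l))) (int (2 * (j + l) + 1))"
    by (rule hh_filtI) auto
qed

text \<open>A staircase: the unwanted \<open>hb (V (Suc l) j)\<close> is, up to sign,
  \<open>hdd (V l (Suc j))\<close>, a total boundary by induction, and is subtracted. It ends at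
  \<open>l = 0\<close>, where \<open>hb\<close> vanishes.\<close>

lemma hd_V_is_boundary:
  "j > 0 \<Longrightarrow> \<exists>w \<in> hh_filt X deg (int (2 * (j + l))) (int (2 * (j + l) + 1)). tot w = hdd (V l j)"
proof (induction l arbitrary: j)
  case 0
  show ?case
    by (rule bexI[OF _ V_filt[OF 0]]) (simp add: hh_total_def hb_V_0)
next
  case (Suc l)
  obtain w where w: "w \<in> hh_filt X deg (int (2 * (Suc j + l))) (int (2 * (Suc j + l) + 1))"
    "tot w = hdd (V l (Suc j))"
    using Suc.IH[of "Suc j"] by auto
  let ?w = "V (Suc l) j - pscale ((-1) ^ Suc l) w"
  have "tot ?w = tot (V (Suc l) j) - pscale ((-1) ^ Suc l) (tot w)"
    by (simp only: linear_map_diff[OF linear_hh_total[OF linear_ident]]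
        linear_map_pscale[OF linear_hh_total[OF linear_ident]])
  also have "\<dots> = hdd (V (Suc l) j)"
  proof -
    have "tot (V (Suc l) j) = pscale ((-1) ^ Suc l) (hdd (V l (Suc j))) + hdd (V (Suc l) j)"
      by (simp only: hh_total_def hb_V[OF Suc.prems])
    then show ?thesis unfolding w(2) by simp
  qed
  finally have "tot ?w = hdd (V (Suc l) j)" .
  moreover have "?w \<in> hh_filt X deg (int (2 * (j + Suc l))) (int (2 * (j + Suc l) + 1))"
    using V_filt[OF Suc.prems, of "Suc l"] w(1) by (intro hh_filt_diff hh_filt_pscale) simp_all
  ultimately show ?case by blast
qed

section \<open>The class c as a total cycle and a total boundary\<close>

definition yclass where "yclass n = {#} # replicate n Y"

text \<open>For \<open>j = 1\<close> the formula \<open>hd_V\<close> reduces to a single term,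
  because \<open>dp 0\<close> and \<open>ip 0\<close> are the unit: it is c itself.\<close>

lemma yclass_is_boundary:
  assumes "n > 0"
  shows "\<exists>w \<in> hh_filt X deg (int (2 * n)) (int (2 * n + 1)). tot w = single (yclass n) (1::'k)"
proof -
  have "hdd (V (n - 1) 1) = T (n - 1) (mon {#}) (mon Y)"
    unfolding hd_V by (simp add: T_zero del: lam_mul_single)
  also have "\<dots> = single (yclass n) 1"
    using assms by (cases n) (auto simp: T_mon yclass_def bas_def replicate_append_same)
  finally show ?thesis using hd_V_is_boundary[of 1 "n - 1"] assms by simp
qed

lemma tot_single: "tot (single ms 1) = hh_b_basis deg r ms + hh_d_basis deg dd ms"
  by (simp add: hh_total_def)

text \<open>The first product 1y and the cyclic product y1 cancel: y passes \<open>n - 1\<close> odd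
  factors, so the sign of the cyclic term is that of the odd number
  \<open>n + (n - 1)\<close>.\<close>

lemma tot_yclass:
  assumes "n > 0" shows "tot (single (yclass n) (1::'k)) = 0"
proof -
  let ?ms = "yclass n"
  obtain k where k: "n = Suc k" using assms by (cases n) auto
  have len: "length ?ms = Suc n" by (simp add: yclass_def)
  have nth: "?ms ! i = (if i = 0 then {#} else Y)" if "i \<le> n" for i
    using that by (auto simp: yclass_def nth_Cons')
  have "(\<Sum>i<n. pscale ((-1) ^ i) (slot (take i ?ms) (mono_mul deg r (?ms ! i) (?ms ! Suc i)) (drop (i + 2) ?ms)))
      = (\<Sum>i\<in>{0}. pscale ((-1) ^ i) (slot (take i ?ms) (mono_mul deg r (?ms ! i) (?ms ! Suc i)) (drop (i + 2) ?ms)) :: _ \<Rightarrow>\<^sub>0 'k)"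
    using assms by (intro sum.mono_neutral_right) (auto simp: nth mono_mul_YY)
  also have "\<dots> = slot [] (mon Y) (replicate k Y)"
    using k by (simp add: nth mono_mul_alt yclass_def)
  finally have "hh_b_basis deg r ?ms = slot [] (mon Y) (replicate k Y)
    + pscale ((-1) ^ (n + ndeg (?ms ! n) * sum_list (map ndeg (take n ?ms))))
       (slot [] (mono_mul deg r (?ms ! n) (?ms ! 0)) (take (n - 1) (tl ?ms)))"
    by (subst hh_b_basis_slot[OF len assms]) simp
  also have "\<dots> = 0"
  proof -
    have "take (n - 1) (tl ?ms) = replicate k Y" "take n ?ms = {#} # replicate k Y"
      by (simp_all add: yclass_def k del: replicate_Suc)
    moreover have "(-1 :: 'k) ^ (n + ndeg Y * sum_list (map ndeg ({#} # replicate k Y))) = -1"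
      by (simp add: k sum_list_replicate)
    moreover have "?ms ! n = Y" "?ms ! 0 = {#}" using nth assms by auto
    moreover have "mono_mul deg r Y {#} = mon Y" by (simp add: mono_mul_alt)
    ultimately show ?thesis by simp
  qed
  finally have "hh_b_basis deg r ?ms = (0 :: _ \<Rightarrow>\<^sub>0 'k)" .
  moreover have "hh_d_basis deg dd ?ms = 0"
  proof -
    have "dd (mon (?ms ! i)) = 0" if "i \<le> n" for i
      using that by (cases "i = 0") (simp_all add: nth)
    then show ?thesis by (subst hh_d_basis_slot[OF len]) simp
  qed
  ultimately show ?thesis by (simp add: tot_single)
qed

lemma yclass_filt: "single (yclass n) c \<in> hh_filt X deg (int n) (int (2 * n))"
  by (rule hh_filtI[of _ X deg n n]) (auto simp: yclass_def hh_basis_def sum_list_replicate)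

section \<open>Boundaries on the second page in bidegree (n, n)\<close>

lemma tl_sum_ge:
  assumes "ms \<in> hh_basis X deg p q" shows "p \<ge> q"
proof -
  have "sum_list (map ndeg t) \<ge> length t" if "{#} \<notin> set t" "set t \<subseteq> M" for t
    using that
  proof (induction t)
    case (Cons m t)
    then have "ndeg m > 0" using ndeg_0_iff[of m] by auto
    then show ?case using Cons by auto
  qed simp
  from this[of "tl ms"] assms show ?thesis
    by (cases ms) (auto simp: hh_basis_def)
qed

text \<open>The entry x stands at list position \<open>Suc i\<close>, after the leading unit and
  \<open>i\<close> factors y. The tensors \<open>tensor_xy n j\<close>, one factor shorter and of
  the same internal degree, serve as coordinates for testing b-cycles.\<close>

definition tensor_x where "tensor_x n i = {#} # map (\<lambda>k. if k = i then {#gx#} else Y) [0..<n]"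
definition tensor_xy where "tensor_xy n j = {#} # map (\<lambda>k. if k = j then {#gx, gy#} else Y) [0..<n - 1]"

text \<open>The last \<open>n\<close> entries have degree at least 1 and the total is
  \<open>n + 1\<close>. The one surplus degree sits in the first entry, which is then y, or turns
  one of the factors y into x.\<close>

lemma hh_basis_top:
  assumes ms: "ms \<in> hh_basis X deg (Suc n) n"
  shows "ms = replicate (Suc n) Y \<or> (\<exists>i<n. ms = tensor_x n i)"
proof -
  obtain m t where mt: "ms = m # t" using ms by (cases ms) (auto simp: hh_basis_def)
  have len: "length t = n" and m: "m \<in> M" and t: "\<And>k. k < n \<Longrightarrow> t ! k \<in> M \<and> t ! k \<noteq> {#}"
    using ms by (auto simp: mt hh_basis_def) (metis nth_mem subsetD)+
  have pos: "ndeg (t ! k) \<ge> 1" if "k < n" for k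
    using t[OF that] ndeg_0_iff[of "t ! k"] by (simp add: Suc_le_eq)
  have "ndeg m + (\<Sum>k<n. ndeg (t ! k)) = Suc n"
  proof -
    have "sum_list (map ndeg t) = (\<Sum>k<n. ndeg (t ! k))"
      by (simp add: sum_list_sum_nth atLeast0LessThan len)
    then show ?thesis using ms by (simp add: mt hh_basis_def)
  qed
  moreover have "(\<Sum>k<n. ndeg (t ! k)) = (\<Sum>k<n. (ndeg (t ! k) - 1) + 1)"
  proof (rule sum.cong)
    fix k assume "k \<in> {..<n}"
    then show "ndeg (t ! k) = (ndeg (t ! k) - 1) + 1" using pos[of k] by simp
  qed simp
  then have "(\<Sum>k<n. ndeg (t ! k)) = (\<Sum>k<n. ndeg (t ! k) - 1) + n"
    by (simp only: sum.distrib) simp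
  ultimately have eq: "ndeg m + (\<Sum>k<n. ndeg (t ! k) - 1) = 1" by simp
  have Y: "t ! k = Y" if "k < n" "ndeg (t ! k) - 1 = 0" for k
  proof -
    have "ndeg (t ! k) = 1" using that(2) pos[OF that(1)] by simp
    then show ?thesis using ndeg_1_iff t[OF that(1)] by blast
  qed
  show ?thesis
  proof (cases "ndeg m = 0")
    case False
    then have "ndeg m = 1" "(\<Sum>k<n. ndeg (t ! k) - 1) = 0" using eq by linarith+
    then have "ndeg m = 1" "\<forall>k<n. ndeg (t ! k) - 1 = 0"
      by (simp_all only: sum_eq_0_iff finite_lessThan) auto
    then have "m = Y" "\<forall>k<n. t ! k = Y" using m Y ndeg_1_iff by auto
    then have "t = replicate n Y" using len by (intro nth_equalityI) auto
    then show ?thesis using \<open>m = Y\<close> by (simp add: mt)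
  next
    case True
    then have "(\<Sum>k<n. ndeg (t ! k) - 1) = 1" using eq by simp
    then obtain i where i: "i < n" "ndeg (t ! i) - 1 = 1" "\<forall>k<n. i \<noteq> k \<longrightarrow> ndeg (t ! k) - 1 = 0"
      using sum_eq_1_iff[of "{..<n}" "\<lambda>k. ndeg (t ! k) - 1"] by blast
    have "ndeg (t ! i) = 2" using i(2) by linarith
    then have "t ! i = {#gx#}" using ndeg_2_iff t[OF i(1)] by blast
    moreover have "t ! k = Y" if "k < n" "k \<noteq> i" for k
      by (rule Y[OF that(1) i(3)[rule_format, OF that(1) that(2)[symmetric]]])
    ultimately have "t = map (\<lambda>k. if k = i then {#gx#} else Y) [0..<n]"
      using len by (intro nth_equalityI) auto
    moreover have "m = {#}" using True m ndeg_0_iff by blast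
    ultimately show ?thesis using i(1) by (auto simp: mt tensor_x_def)
  qed
qed

lemma tensor_x_nth: "k \<le> n \<Longrightarrow> tensor_x n i ! k = (if k = 0 then {#} else if k = Suc i then {#gx#} else Y)"
  by (auto simp: tensor_x_def nth_Cons')

lemma tensor_xy_nth: "k < n \<Longrightarrow> tensor_xy n j ! k = (if k = 0 then {#} else if k = Suc j then {#gx, gy#} else Y)"
  by (auto simp: tensor_xy_def nth_Cons')

lemma tensor_x_length [simp]: "length (tensor_x n i) = Suc n" by (simp add: tensor_x_def)

lemma tensor_xy_length [simp]: "n > 0 \<Longrightarrow> length (tensor_xy n j) = n" by (simp add: tensor_xy_def)

lemma tensor_xy_tl: "{#} \<notin> set (tl (tensor_xy n j))" by (auto simp: tensor_xy_def)

lemma tensor_x_in_basis: "i < n \<Longrightarrow> {#} \<notin> set (tl (tensor_x n i))" by (auto simp: tensor_x_def)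

text \<open>A product at another place would have to equal the unit or the single generator y, yet
  it contains a nonunit at place 0 and in the cyclic term, and two nonunits elsewhere.\<close>

lemma hb_lookup_xy:
  assumes ms: "length ms = Suc n" "{#} \<notin> set (tl ms)" "set ms \<subseteq> M" and j: "Suc j < n"
  shows "lookup (hh_b_basis deg r ms) (tensor_xy n j) = (-1 :: 'k) ^ Suc j * lookup (slot (take (Suc j) ms)
      (mono_mul deg r (ms ! Suc j) (ms ! Suc (Suc j))) (drop (Suc j + 2) ms)) (tensor_xy n j)"
proof -
  let ?S = "\<lambda>i. slot (take i ms) (mono_mul deg r (ms ! i) (ms ! Suc i)) (drop (i + 2) ms) :: _ \<Rightarrow>\<^sub>0 'k"
  have pos: "ms ! Suc i \<in> M \<and> ms ! Suc i \<noteq> {#}" if "i < n" for i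
  proof -
    have "ms ! Suc i \<in> set (tl ms)" using that ms(1) by (cases ms) auto
    moreover have "ms ! Suc i \<in> set ms" using that ms(1) by simp
    ultimately show ?thesis using ms(2,3) by (metis subsetD)
  qed
  have keys: "keys (mono_mul deg r m m' :: _ \<Rightarrow>\<^sub>0 'k) \<subseteq> {m + m'}" for m m'
    by (simp add: mono_mul_alt)
  have zero: "lookup (?S i) (tensor_xy n j) = 0" if "i < n" "i \<noteq> Suc j" for i
  proof (rule lookup_slot_zero)
    fix m assume "m \<in> keys (mono_mul deg r (ms ! i) (ms ! Suc i) :: _ \<Rightarrow>\<^sub>0 'k)"
    then have m: "m = ms ! i + ms ! Suc i" using keys by blast
    have nth: "(take i ms @ m # drop (i + 2) ms) ! i = m" using that ms(1) by (simp add: nth_append)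
    show "tensor_xy n j \<noteq> take i ms @ m # drop (i + 2) ms"
    proof
      assume "tensor_xy n j = take i ms @ m # drop (i + 2) ms"
      then have *: "tensor_xy n j ! i = ms ! i + ms ! Suc i" using nth m by simp
      show False
      proof (cases i)
        case 0
        then show ?thesis using * pos[of 0] that tensor_xy_nth[of 0 n j] by simp
      next
        case (Suc k)
        then have "Y = ms ! Suc k + ms ! Suc i" using * tensor_xy_nth[OF that(1), of j] that by simp
        then have "size Y = size (ms ! Suc k) + size (ms ! Suc i)" by (metis size_union)
        moreover have "size (ms ! Suc k) > 0" "size (ms ! Suc i) > 0"
          using pos[of k] pos[of i] that Suc by (auto simp: nonempty_has_size)
        ultimately show ?thesis by simp
      qed
    qed
  qed
  have cyc: "lookup (slot [] (mono_mul deg r (ms ! n) (ms ! 0)) l :: _ \<Rightarrow>\<^sub>0 'k) (tensor_xy n j) = 0" for l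
  proof (rule lookup_slot_zero)
    fix m assume "m \<in> keys (mono_mul deg r (ms ! n) (ms ! 0) :: _ \<Rightarrow>\<^sub>0 'k)"
    then have "m = ms ! n + ms ! 0" using keys by blast
    then show "tensor_xy n j \<noteq> [] @ m # l" using pos[of "n - 1"] j by (auto simp: tensor_xy_def)
  qed
  have "lookup (hh_b_basis deg r ms) (tensor_xy n j) = (\<Sum>i<n. (-1) ^ i * lookup (?S i) (tensor_xy n j))"
    using j by (subst hh_b_basis_slot[OF ms(1)]) (simp_all add: lookup_add lookup_sum cyc)
  also have "\<dots> = (\<Sum>i\<in>{Suc j}. (-1) ^ i * lookup (?S i) (tensor_xy n j))"
    by (rule sum.mono_neutral_right) (use zero j in auto)
  finally show ?thesis by simp
qed

lemma mono_mul_XY: "mono_mul deg r {#gx#} Y = mon {#gx, gy#}" "mono_mul deg r Y {#gx#} = mon {#gx, gy#}"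
proof -
  have "odds deg {#gx#} = {}" by (auto simp: odds_def)
  then show "mono_mul deg r {#gx#} Y = mon {#gx, gy#}" "mono_mul deg r Y {#gx#} = mon {#gx, gy#}"
    by (auto simp: mono_mul_alt inversions_def add_mset_commute)
qed

lemma tensor_x_merge: "\<lbrakk>Suc j < n; i = j \<or> i = Suc j\<rbrakk>
    \<Longrightarrow> take (Suc j) (tensor_x n i) @ {#gx, gy#} # drop (Suc j + 2) (tensor_x n i) = tensor_xy n j"
  by (rule nth_equalityI) (auto simp: tensor_xy_nth nth_append nth_Cons' tensor_x_nth)

text \<open>The even x merges with the y on either side of it without a sign, so the neighbours
  \<open>i = j\<close> and \<open>i = Suc j\<close> have the same coefficient.\<close>

lemma hb_tensor_x_lookup:
  assumes "Suc j < n" "i < n"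
  shows "lookup (hh_b_basis deg r (tensor_x n i) :: _ \<Rightarrow>\<^sub>0 'k) (tensor_xy n j)
    = (if i = j \<or> i = Suc j then (-1) ^ Suc j else 0)"
proof -
  have M: "set (tensor_x n i) \<subseteq> M" by (auto simp: tensor_x_def)
  have *: "lookup (hh_b_basis deg r (tensor_x n i) :: _ \<Rightarrow>\<^sub>0 'k) (tensor_xy n j) = (-1) ^ Suc j * lookup (slot (take (Suc j) (tensor_x n i))
      (mono_mul deg r (tensor_x n i ! Suc j) (tensor_x n i ! Suc (Suc j))) (drop (Suc j + 2) (tensor_x n i))) (tensor_xy n j)"
    by (rule hb_lookup_xy[OF tensor_x_length tensor_x_in_basis[OF assms(2)] M assms(1)])
  show ?thesis
  proof (cases "i = j \<or> i = Suc j")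
    case True
    then have "mono_mul deg r (tensor_x n i ! Suc j) (tensor_x n i ! Suc (Suc j)) = mon {#gx, gy#}"
      using assms by (auto simp: tensor_x_nth mono_mul_XY)
    then show ?thesis
      using True * tensor_x_merge[OF assms(1) True] tensor_xy_tl[of n j] by (simp add: lookup_bas)
  next
    case False
    then have "mono_mul deg r (tensor_x n i ! Suc j) (tensor_x n i ! Suc (Suc j)) = (0 :: _ \<Rightarrow>\<^sub>0 'k)"
      using assms by (auto simp: tensor_x_nth mono_mul_YY)
    then show ?thesis using False * by simp
  qed
qed

lemma hb_replicate_lookup:
  assumes "Suc j < n"
  shows "lookup (hh_b_basis deg r (replicate (Suc n) Y) :: _ \<Rightarrow>\<^sub>0 'k) (tensor_xy n j) = 0"
  using assms by (subst hb_lookup_xy) (auto simp: mono_mul_YY simp del: replicate_Suc)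

text \<open>The number of tensor factors separates \<open>b\<close> from the internal boundary, so
  each coefficient of the total differential of a basis element involves only one of them.\<close>

lemma hb_lookup_length:
  assumes "length ms = Suc n" "n > 0" "length L \<noteq> n"
  shows "lookup (hh_b_basis deg r ms) L = (0 :: 'k)"
proof -
  have "lookup (slot (take i ms) f (drop (i + 2) ms)) L = (0 :: 'k)" if "i < n" for i f
    by (rule lookup_slot_zero) (use that assms in auto)
  moreover have "lookup (slot [] f (take (n - 1) (tl ms))) L = (0 :: 'k)" for f
    by (rule lookup_slot_zero) (use assms in auto)
  ultimately show ?thesis
    by (subst hh_b_basis_slot[OF assms(1,2)]) (simp add: lookup_add lookup_sum)
qed

lemma hd_lookup_length:
  assumes "length ms = Suc n" "length L \<noteq> Suc n"
  shows "lookup (hh_d_basis deg dd ms) L = (0 :: 'k)"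
proof -
  have "lookup (slot (take i ms) f (drop (Suc i) ms)) L = (0 :: 'k)" if "i \<le> n" for i f
    by (rule lookup_slot_zero) (use that assms in auto)
  then show ?thesis
    by (subst hh_d_basis_slot[OF assms(1)]) (simp add: lookup_sum)
qed

lemma hd_replicate: "hh_d_basis deg dd (replicate (Suc n) Y) = (0 :: _ \<Rightarrow>\<^sub>0 'k)"
  by (subst hh_d_basis_slot[of _ n]) (simp_all del: replicate_Suc)

text \<open>Only x has a nonzero boundary, namely y. The column sign is \<open>(-1) ^ n\<close>, and
  the \<open>i\<close> factors y in front of x contribute \<open>(-1) ^ i\<close>.\<close>

lemma hd_tensor_x_lookup:
  assumes "i < n"
  shows "lookup (hh_d_basis deg dd (tensor_x n i)) (yclass n) = (-1 :: 'k) ^ (n + i)"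
proof -
  let ?t = "\<lambda>k. (-1) ^ sum_list (map ndeg (take k (tensor_x n i))) * lookup (slot (take k (tensor_x n i))
    (dd (mon (tensor_x n i ! k))) (drop (Suc k) (tensor_x n i))) (yclass n) :: 'k"
  have "(\<Sum>k\<le>n. ?t k) = (\<Sum>k\<in>{Suc i}. ?t k)"
    by (rule sum.mono_neutral_right) (use assms in \<open>auto simp: tensor_x_nth\<close>)
  also have "\<dots> = (-1) ^ i"
  proof -
    have "take (Suc i) (tensor_x n i) = {#} # replicate i Y"
      by (rule nth_equalityI) (use assms in \<open>auto simp: tensor_x_nth nth_Cons'\<close>)
    moreover have "take (Suc i) (tensor_x n i) @ Y # drop (Suc (Suc i)) (tensor_x n i) = yclass n"
      by (rule nth_equalityI) (use assms in \<open>auto simp: tensor_x_nth nth_Cons' nth_append yclass_def\<close>)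
    moreover have "{#} \<notin> set (tl (yclass n))" by (simp add: yclass_def)
    ultimately show ?thesis
      using assms by (simp add: tensor_x_nth lookup_bas sum_list_replicate)
  qed
  finally show ?thesis
    by (subst hh_d_basis_slot[of _ n]) (simp_all add: lookup_sum power_add)
qed

text \<open>Coefficients of \<open>tot u\<close> are compared at \<open>tensor_xy n j\<close>, where
  they vanish, and at \<open>yclass n\<close>, where they give 1. The inverse of \<open>n\<close>
  is, up to sign, the coefficient of \<open>tensor_x n 0\<close> in \<open>u\<close>.\<close>

lemma invertible_if_boundary:
  assumes n: "n > 0" and c: "single (yclass n) 1 \<in> hh_B X deg r dd 2 (int n) (int n)"
  shows "\<exists>u::'k. of_nat n * u = 1"
proof -
  obtain u w where u: "u \<in> hh_A X deg r dd 1 (int n + 1) (2 * int n + 1)"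
    and w: "w \<in> hh_filt X deg (int n - 1) (2 * int n)" and eq: "single (yclass n) 1 = tot u + w"
  proof -
    have e: "int n + int 2 - 1 = int n + 1" "int n + int n + 1 = 2 * int n + 1"
      "int n + int n = 2 * int n" "2 - 1 = (1::nat)" by auto
    show ?thesis using c that unfolding hh_B_def e by blast
  qed
  define b where "b i = lookup u (tensor_x n i)" for i
  let ?S = "insert (replicate (Suc n) Y) (tensor_x n ` {..<n})"
  have S: "keys u \<subseteq> ?S"
  proof
    fix ms assume "ms \<in> keys u"
    then obtain p q where pq: "ms \<in> hh_basis X deg p q" "int p + int q = 2 * int n + 1" "int p \<le> int n + 1"
      using u hh_filtD unfolding hh_A_def by blast
    \<comment> \<open>From \<open>q \<le> p\<close>, \<open>p + q = 2 * n + 1\<close> and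
      \<open>p \<le> n + 1\<close> a single bidegree remains.\<close>
    then have "p = Suc n" "q = n" using tl_sum_ge[OF pq(1)] by auto
    then show "ms \<in> ?S" using pq(1) hh_basis_top by auto
  qed
  have inj: "inj_on (tensor_x n) {..<n}"
  proof (rule inj_onI)
    fix i k assume "i \<in> {..<n}" "k \<in> {..<n}" "tensor_x n i = tensor_x n k"
    then have "tensor_x n k ! Suc i = {#gx#}" by (metis tensor_x_nth Suc_leI lessThan_iff nat.distinct(1))
    then show "i = k" using \<open>i \<in> {..<n}\<close> by (auto simp: tensor_x_nth split: if_splits)
  qed
  have notin: "replicate (Suc n) Y \<notin> tensor_x n ` {..<n}" by (auto simp: tensor_x_def)
  have tot: "lookup (tot u) L = (\<Sum>i<n. b i * lookup (tot (single (tensor_x n i) 1)) L)"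
    if "lookup (tot (single (replicate (Suc n) Y) (1::'k))) L = 0" for L
  proof -
    have "tot u = (\<Sum>ms\<in>?S. pscale (lookup u ms) (tot (single ms 1)))"
      using linear_map_expand[OF linear_hh_total[OF linear_ident], of deg r dd u]
        lin_ext_superset[OF _ S, of "\<lambda>ms. tot (single ms 1)"] by simp
    then have "lookup (tot u) L = (\<Sum>ms\<in>?S. lookup u ms * lookup (tot (single ms 1)) L)"
      by (simp add: lookup_sum)
    also have "\<dots> = (\<Sum>ms\<in>tensor_x n ` {..<n}. lookup u ms * lookup (tot (single ms 1)) L)"
      using that notin by (simp del: replicate_Suc)
    finally show ?thesis by (simp add: sum.reindex[OF inj] b_def)
  qed
  \<comment> \<open>As \<open>u\<close> lies in \<open>hh_A\<close> with index 1,
    \<open>tot u\<close> has filtration at most \<open>n\<close>, while \<open>tensor_xy n j\<close>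
    has internal degree \<open>n + 1\<close>. This is the cycle condition for
    \<open>b\<close>.\<close>
  have rel: "b j + b (Suc j) = 0" if j: "Suc j < n" for j
  proof -
    have "sum_list (map ndeg (tensor_xy n j)) = Suc n"
    proof -
      have "map ndeg (map (\<lambda>k. if k = j then {#gx, gy#} else Y) [0..<n - 1])
          = map (\<lambda>k. (if k = j then 2 else 0) + 1) [0..<n - 1]"
        by auto
      then have "sum_list (map ndeg (tensor_xy n j)) = sum_list (map (\<lambda>k. (if k = j then 2 else 0) + 1) [0..<n - 1])"
        by (simp only: tensor_xy_def list.map sum_list.Cons mdeg_simps add_0_left)
      also have "\<dots> = (\<Sum>k<n - 1. (if k = j then 2 else 0) + 1)"
        by (simp only: interv_sum_list_conv_sum_set_nat set_upt atLeast0LessThan)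
      also have "\<dots> = Suc n" using j by (simp only: sum.distrib) simp
      finally show ?thesis .
    qed
    then have "lookup (tot u) (tensor_xy n j) = 0"
      using u by (intro hh_filt_lookup[of _ X deg "int n" "2 * int n"]) (auto simp: hh_A_def)
    moreover have "lookup (tot (single (replicate (Suc n) Y) (1::'k))) (tensor_xy n j) = 0"
      using n by (simp add: tot_single lookup_add hb_replicate_lookup[OF j] hd_replicate del: replicate_Suc)
    moreover have "lookup (tot (single (tensor_x n i) (1::'k))) (tensor_xy n j)
        = (if i = j \<or> i = Suc j then (-1) ^ Suc j else 0)" if "i < n" for i
      using n by (simp only: tot_single lookup_add hb_tensor_x_lookup[OF j that]
          hd_lookup_length[OF tensor_x_length] tensor_xy_length) simp
    ultimately have "(\<Sum>i<n. b i * (if i = j \<or> i = Suc j then (-1) ^ Suc j else 0)) = 0"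
      using tot[of "tensor_xy n j"] by (simp del: power_Suc)
    moreover have "(\<Sum>i<n. b i * (if i = j \<or> i = Suc j then (-1) ^ Suc j else 0))
        = (\<Sum>i\<in>{j, Suc j}. b i * (-1) ^ Suc j)"
      by (rule sum.mono_neutral_cong_right) (use j in auto)
    ultimately have "(b j + b (Suc j)) * (-1) ^ Suc j = 0" by (simp add: algebra_simps)
    then have "(b j + b (Suc j)) * (-1) ^ Suc j * (-1) ^ Suc j = 0" by simp
    then show ?thesis by (simp only: mult.assoc minus_one_mult_self mult_1_right)
  qed
  have b: "b i = (-1) ^ i * b 0" if "i < n" for i
    using that
  proof (induction i)
    case (Suc i)
    then have "b (Suc i) = - b i" using rel[of i] by (simp add: eq_neg_iff_add_eq_0 add.commute)
    then show ?case using Suc by simp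
  qed simp
  have len: "length (yclass n) = Suc n" by (simp add: yclass_def)
  have "1 = lookup (tot u + w) (yclass n)" by (simp flip: eq)
  also have "\<dots> = lookup (tot u) (yclass n)"
    using hh_filt_lookup[OF w, of "yclass n"] by (simp add: lookup_add yclass_def sum_list_replicate)
  also have "\<dots> = (\<Sum>i<n. b i * lookup (tot (single (tensor_x n i) 1)) (yclass n))"
  proof (rule tot)
    show "lookup (tot (single (replicate (Suc n) Y) (1::'k))) (yclass n) = 0"
      using n len by (simp add: tot_single lookup_add hd_replicate hb_lookup_length[of _ n] del: replicate_Suc)
  qed
  \<comment> \<open>The alternation of the coefficients of \<open>u\<close> cancels the alternating
    sign of \<partial>, so all \<open>n\<close> summands are equal.\<close>
  also have "\<dots> = (\<Sum>i<n. (-1) ^ n * b 0)"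
  proof (rule sum.cong)
    fix i assume "i \<in> {..<n}"
    then have i: "i < n" by simp
    have "lookup (tot (single (tensor_x n i) (1::'k))) (yclass n) = (-1) ^ (n + i)"
      using n len i by (simp add: tot_single lookup_add hd_tensor_x_lookup hb_lookup_length[of _ n])
    then show "b i * lookup (tot (single (tensor_x n i) 1)) (yclass n) = (-1) ^ n * b 0"
      unfolding b[OF i]
      by (simp add: power_add ac_simps)
  qed simp
  finally have "of_nat n * ((-1) ^ n * b 0) = 1" by simp
  then show ?thesis by blast
qed

text \<open>A total cycle lies in every \<open>hh_Z\<close> and a total boundary in some
  \<open>hh_B\<close>; degeneration then moves the class into \<open>hh_B\<close> with index
  2.\<close>

lemma invertible_if_degenerate:
  assumes n: "n > 0" and deg: "degenerates_at_E2 X deg r dd"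
  shows "\<exists>u::'k. of_nat n * u = 1"
proof (rule invertible_if_boundary[OF n])
  let ?c = "single (yclass n) (1::'k)"
  have Z: "x \<in> hh_Z X deg r dd k (int n) (int n)" if "x \<in> {0, ?c}" for x k
  proof -
    have "x \<in> hh_A X deg r dd k (int n) (int n + int n)"
    proof -
      have e: "int n + int n = int (2 * n)" by simp
      show ?thesis
        using that tot_yclass[OF n] yclass_filt[of n 1] unfolding e
        by (auto simp: hh_A_def linear_map_0[OF linear_hh_total[OF linear_ident]])
    qed
    then have "x + 0 \<in> hh_Z X deg r dd k (int n) (int n)"
      unfolding hh_Z_def using hh_filt_zero by blast
    then show ?thesis by simp
  qed
  \<comment> \<open>The bounding chain has filtration \<open>2 * n = n + k - 1\<close>, so the page
    is \<open>k = n + 1\<close>. The element \<open>0\<close> is treated along with the class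
    because \<open>subquot_eqD\<close> needs both.\<close>
  have B: "x \<in> hh_B X deg r dd (Suc n) (int n) (int n)" if x: "x \<in> {0, ?c}" for x
  proof -
    obtain w where w: "w \<in> hh_filt X deg (int (2 * n)) (int (2 * n + 1))" "tot w = x"
    proof (cases "x = 0")
      case True
      then show ?thesis using that[of 0] by (simp add: linear_map_0[OF linear_hh_total[OF linear_ident]])
    next
      case False
      then show ?thesis using that yclass_is_boundary[OF n] x by auto
    qed
    have "x \<in> hh_filt X deg (int n) (int (2 * n))" using x yclass_filt[of n 1] by auto
    then have "w \<in> hh_A X deg r dd (Suc n - 1) (int n + int (Suc n) - 1) (int n + int n + 1)"
    proof -
      have e: "Suc n - 1 = n" "int n + int (Suc n) - 1 = int (2 * n)"
        "int n + int n + 1 = int (2 * n + 1)" by auto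
      have e': "int (2 * n) - int n = int n" "int (2 * n + 1) - 1 = int (2 * n)" by auto
      show ?thesis
        unfolding hh_A_def e e' using w \<open>x \<in> hh_filt X deg (int n) (int (2 * n))\<close> by simp
    qed
    then have "tot w + 0 \<in> hh_B X deg r dd (Suc n) (int n) (int n)"
      unfolding hh_B_def using hh_filt_zero by blast
    then show ?thesis using w by simp
  qed
  show "?c \<in> hh_B X deg r dd 2 (int n) (int n)"
  proof (rule subquot_eqD)
    show "subquot (hh_Z X deg r dd 2 (int n) (int n)) (hh_B X deg r dd 2 (int n) (int n))
        = subquot (\<Inter>k\<in>{1..}. hh_Z X deg r dd k (int n) (int n))
            (\<Union>k\<in>{1..}. hh_B X deg r dd k (int n) (int n))"
      using deg by (simp add: degenerates_at_E2_def hh_E_def hh_E_infinity_def)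
  qed (use Z B hh_B_diff in \<open>auto intro!: bexI[of _ "Suc n"]\<close>)
qed

end

theorem proposition2p4:
  assumes "infinite (UNIV :: 'x set)"
    and "\<exists>g :: 'k::comm_ring_1 \<Rightarrow> 'x. inj g"
    and "\<And>(X :: 'x set) deg r d (\<epsilon> :: ('x multiset \<Rightarrow>\<^sub>0 'k) \<Rightarrow> 'k).
           is_model X deg r d ground \<epsilon> \<Longrightarrow> degenerates_at_E2 X deg r d"
  shows "\<forall>n::nat. n > 0 \<longrightarrow> (\<exists>u::'k. of_nat n * u = 1)"
proof -
  obtain X deg r and s :: "'x multiset \<Rightarrow> 'x" where "cone_generators X deg r s"
    using cone_generators_exist[OF assms(1)] by blast
  then interpret cone_generators X deg r s .
  \<comment> \<open>The generators do not depend on the coefficients; the ring \<open>'k\<close>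
    enters only with the boundary.\<close>
  interpret cone_algebra X deg r s "cone_bdry :: 'x \<Rightarrow> 'x multiset \<Rightarrow>\<^sub>0 'k"
    by unfold_locales (rule cone_bdry_s)
  show ?thesis
    using invertible_if_degenerate assms(3)[OF cone_is_model] by blast
qed

end
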